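(* Let $\alpha,\beta,\gamma\in\mathbb{R}$ with $|\alpha|<1$ and $|\gamma|<1$, and let $(X_t,Y_t)_{t\in\mathbb{Z}}$ be the stationary solution of the autoregressive model $X_{t+1}=\alpha X_t+E^X_t$, $Y_{t+1}=\beta X_t+\gamma Y_t+E^Y_t$, $t\in\mathbb{Z}$, where $(E^X_t)_{t\in\mathbb{Z}}$, $(E^Y_t)_{t\in\mathbb{Z}}$ are jointly i.i.d. $\mathcal{N}(0,1)$ random variables. Let $f,g\in\ell^1(\mathbb{Z})$ be real-valued and related by $$f=\beta S(I-\gamma S)^{-1}g,\qquad (Sh)(t):=h(t+1).$$ Put $X_f:=\sum_{t\in\mathbb{Z}}f(t)X_t$ and $Y_g:=\sum_{t\in\mathbb{Z}}g(t)Y_t$. Then there are independent zero-mean Gaussian random variables $\tilde E^X,\tilde E^Y$ with $$X_f=\tilde E^X,\qquad Y_g=X_f+\tilde E^Y,$$ whose variances are $$\mathbb{V}(\tilde E^X)=\sum_{t\in\mathbb{Z}}\sum_{k,k'\ge 0}\alpha^{k+k'}f(t+k')f(t+k),\qquad \mathbb{V}(\tilde E^Y)=\sum_{t\in\mathbb{Z}}\sum_{k,k'\ge 0}\gamma^{k+k'}g(t+k')g(t+k).$$ Moreover, the equation $Y_g=X_f+\tilde E^Y$ is a structural equation in the following sense: (i) (observational) the conditional distribution of $Y_g$ given $X_f=x$ is the distribution of $x+\tilde E^Y$ (for almost every $x$ with respect to the law of $X_f$); (ii) (interventional) for every $x\in\mathbb{R}$ and every bounded real sequence $\mathbf{x}=(x_t)_{t\in\mathbb{Z}}$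 with $\sum_{t\in\mathbb{Z}}f(t)x_t=x$, the variable $Y_g^{do(\mathbf{X}=\mathbf{x})}$ has the distribution of $x+\tilde E^Y$. In particular it depends on the intervention only through the value $x$ that the intervention gives to $X_f$.
   Context: The stationary solution (the process "goes back forever") is $X_{t+1}=\sum_{k\ge0}\alpha^kE^X_{t-k}$ and $Y_{t+1}=\sum_{k\ge0}\gamma^k(\beta X_{t-k}+E^Y_{t-k})$, with the series converging in $L^1$ of the probability space. For $f,g\in\ell^1(\mathbb{Z})$ the series defining $X_f$ and $Y_g$ converge in $L^1$. The operator $(I-\gamma S)^{-1}$ on $\ell^1(\mathbb{Z})$ is given by the norm-convergent Neumann series $\sum_{j\ge0}(\gamma S)^j$. Intervention: for a bounded real sequence $\mathbf{x}=(x_t)_{t\in\mathbb{Z}}$, $do(\mathbf{X}=\mathbf{x})$ means that each $X_t$ is set to the constant $x_t$ (the equation for $X_{t+1}$ is dropped), while the equation for $Y$ is kept: $Y^{do(\mathbf{X}=\mathbf{x})}_{t+1}=\beta x_t+\gamma Y^{do(\mathbf{X}=\mathbf{x})}_t+E^Y_t$ for all $t\in\mathbb{Z}$, with the solution going back forever, $Y^{do(\mathbf{X}=\mathbf{x})}_{t+1}=\sum_{k\ge0}\gamma^k(\beta x_{t-k}+E^Y_{t-k})$. Then $Y_g^{do(\mathbf{X}=\mathbf{x})}:=\sum_{t\in\mathbb{Z}}g(t)Y_t^{do(\mathbf{X}=\mathbf{x})}$. *)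

theory Defs
  imports "HOL-Probability.Probability"
begin

definition ell1 :: "(int \<Rightarrow> real) set" where
  "ell1 = {h. (\<lambda>t. \<bar>h t\<bar>) summable_on UNIV}"

definition shift :: "(int \<Rightarrow> real) \<Rightarrow> int \<Rightarrow> real" where
  "shift h = (\<lambda>t. h (t + 1))"

text \<open>
  The operator \<open>(I - c S)\<^sup>-\<^sup>1\<close> on \<^term>\<open>ell1\<close>, as the inverse of the map \<open>I - c S\<close>.
  Lemmas \<open>bij_betw_id_minus_shift\<close> and \<open>neumann_series\<close> below show that for \<open>\<bar>c\<bar> < 1\<close> this
  inverse exists and is the norm limit of the Neumann series.
\<close>

definition inv_id_minus_shift :: "real \<Rightarrow> (int \<Rightarrow> real) \<Rightarrow> int \<Rightarrow> real" where
  "inv_id_minus_shift c = the_inv_into ell1 (\<lambda>h t. h t - c * shift h t)"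

text \<open>
  Convergence of a series of random variables in the \<open>L\<^sup>1\<close> norm, along the net of finite partial
  sums (as for \<^const>\<open>has_sum\<close>). Limits are determined only up to null sets;
  \<open>L1_sum\<close> picks some version.
\<close>

definition has_L1_sum ::
    "'a measure \<Rightarrow> ('i \<Rightarrow> 'a \<Rightarrow> real) \<Rightarrow> 'i set \<Rightarrow> ('a \<Rightarrow> real) \<Rightarrow> bool" where
  "has_L1_sum M F A L \<longleftrightarrow>
     (\<forall>i\<in>A. integrable M (F i)) \<and> integrable M L \<and>
     ((\<lambda>I. \<integral>\<omega>. \<bar>(\<Sum>i\<in>I. F i \<omega>) - L \<omega>\<bar> \<partial>M) \<longlongrightarrow> 0) (finite_subsets_at_top A)"

definition L1_summable :: "'a measure \<Rightarrow> ('i \<Rightarrow> 'a \<Rightarrow> real) \<Rightarrow> 'i set \<Rightarrow> bool" where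
  "L1_summable M F A \<longleftrightarrow> (\<exists>L. has_L1_sum M F A L)"

definition L1_sum :: "'a measure \<Rightarrow> ('i \<Rightarrow> 'a \<Rightarrow> real) \<Rightarrow> 'i set \<Rightarrow> 'a \<Rightarrow> real" where
  "L1_sum M F A = (SOME L. has_L1_sum M F A L)"

definition jointly_iid_std_normal ::
    "'a measure \<Rightarrow> (int \<Rightarrow> 'a \<Rightarrow> real) \<Rightarrow> (int \<Rightarrow> 'a \<Rightarrow> real) \<Rightarrow> bool" where
  "jointly_iid_std_normal M eX eY \<longleftrightarrow>
     prob_space.indep_vars M (\<lambda>_. borel) (case_sum eX eY) (UNIV :: (int + int) set) \<and>
     (\<forall>t. distributed M lborel (eX t) std_normal_density) \<and>
     (\<forall>t. distributed M lborel (eY t) std_normal_density)"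

text \<open>
  \<open>Z\<close> solves \<open>Z\<^sub>t\<^sub>+\<^sub>1 = c Z\<^sub>t + U\<^sub>t\<close> and goes back forever. The series already implies the recursion.
\<close>

definition ar1_solution ::
    "'a measure \<Rightarrow> real \<Rightarrow> (int \<Rightarrow> 'a \<Rightarrow> real) \<Rightarrow> (int \<Rightarrow> 'a \<Rightarrow> real) \<Rightarrow> bool" where
  "ar1_solution M c U Z \<longleftrightarrow>
     (\<forall>t. AE \<omega> in M. Z (t + 1) \<omega> = c * Z t \<omega> + U t \<omega>) \<and>
     (\<forall>t. has_L1_sum M (\<lambda>k \<omega>. c ^ k * U (t - int k) \<omega>) (UNIV :: nat set) (Z (t + 1)))"

definition stationary_solution ::
    "'a measure \<Rightarrow> real \<Rightarrow> real \<Rightarrow> real \<Rightarrow> (int \<Rightarrow> 'a \<Rightarrow> real) \<Rightarrow> (int \<Rightarrow> 'a \<Rightarrow> real) \<Rightarrow>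
     (int \<Rightarrow> 'a \<Rightarrow> real) \<Rightarrow> (int \<Rightarrow> 'a \<Rightarrow> real) \<Rightarrow> bool" where
  "stationary_solution M \<alpha> \<beta> \<gamma> eX eY X Y \<longleftrightarrow>
     ar1_solution M \<alpha> eX X \<and>
     ar1_solution M \<gamma> (\<lambda>t \<omega>. \<beta> * X t \<omega> + eY t \<omega>) Y"

text \<open>
  The intervention \<open>do(X = xs)\<close> drops the equation for \<open>X\<close> and keeps the one for \<open>Y\<close>, with the
  constant \<open>xs t\<close> in place of \<open>X t\<close>.
\<close>

definition do_solution ::
    "'a measure \<Rightarrow> real \<Rightarrow> real \<Rightarrow> (int \<Rightarrow> 'a \<Rightarrow> real) \<Rightarrow> (int \<Rightarrow> real) \<Rightarrow>
     (int \<Rightarrow> 'a \<Rightarrow> real) \<Rightarrow> bool" where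
  "do_solution M \<beta> \<gamma> eY xs Ydo \<longleftrightarrow>
     ar1_solution M \<gamma> (\<lambda>t \<omega>. \<beta> * xs t + eY t \<omega>) Ydo"

definition lin_comb ::
    "'a measure \<Rightarrow> (int \<Rightarrow> real) \<Rightarrow> (int \<Rightarrow> 'a \<Rightarrow> real) \<Rightarrow> 'a \<Rightarrow> real" where
  "lin_comb M h Z = L1_sum M (\<lambda>t \<omega>. h t * Z t \<omega>) UNIV"

text \<open>The point masses count as Gaussian: for \<open>f = 0\<close> or \<open>g = 0\<close> the variances vanish.\<close>

definition gaussian_rv :: "'a measure \<Rightarrow> ('a \<Rightarrow> real) \<Rightarrow> bool" where
  "gaussian_rv M Z \<longleftrightarrow>
     Z \<in> borel_measurable M \<and>
     (\<exists>\<mu> \<sigma>. 0 \<le> \<sigma> \<and>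
        distr M borel Z =
          (if \<sigma> = 0 then return borel \<mu> else density lborel (normal_density \<mu> \<sigma>)))"

text \<open>
  \<open>is_cond_distr M U V K\<close>: \<open>K\<close> is a regular conditional distribution of \<open>V\<close> given \<open>U\<close>.
\<close>

definition is_cond_distr ::
    "'a measure \<Rightarrow> ('a \<Rightarrow> real) \<Rightarrow> ('a \<Rightarrow> real) \<Rightarrow> (real \<Rightarrow> real measure) \<Rightarrow> bool" where
  "is_cond_distr M U V K \<longleftrightarrow>
     K \<in> borel \<rightarrow>\<^sub>M prob_algebra borel \<and>
     (\<forall>A\<in>sets borel. \<forall>B\<in>sets borel.
        emeasure M {\<omega> \<in> space M. U \<omega> \<in> A \<and> V \<omega> \<in> B} =
        (\<integral>\<^sup>+ u \<in> A. emeasure (K u) B \<partial>distr M borel U))"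

lemma ell1_shift_power:
  assumes "h \<in> ell1"
  shows "(\<lambda>t. \<bar>h (t + j)\<bar>) summable_on UNIV" "(\<Sum>\<^sub>\<infinity>t. \<bar>h (t + j)\<bar>) = (\<Sum>\<^sub>\<infinity>t. \<bar>h t\<bar>)"
proof -
  have b: "bij_betw (\<lambda>t::int. t + j) UNIV UNIV"
    by (rule bij_betwI[where g="\<lambda>t. t - j"]) auto
  show "(\<lambda>t. \<bar>h (t + j)\<bar>) summable_on UNIV"
    using assms summable_on_reindex_bij_betw[OF b, of "\<lambda>t. \<bar>h t\<bar>"] by (simp add: ell1_def)
  show "(\<Sum>\<^sub>\<infinity>t. \<bar>h (t + j)\<bar>) = (\<Sum>\<^sub>\<infinity>t. \<bar>h t\<bar>)"
    using infsum_reindex_bij_betw[OF b, of "\<lambda>t. \<bar>h t\<bar>"] by simp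
qed

lemma shift_power: "(shift ^^ j) h t = h (t + int j)"
  by (induction j arbitrary: t) (auto simp: shift_def algebra_simps)

lemma neumann_aux:
  assumes c: "\<bar>c\<bar> < 1" and g: "g \<in> ell1"
  defines "h \<equiv> (\<lambda>t. \<Sum>j. c ^ j * g (t + int j))"
  shows "\<And>t. summable (\<lambda>j. c ^ j * g (t + int j))"
    and "\<And>t. h t - c * shift h t = g t"
    and "h \<in> ell1"
    and "(\<lambda>n. \<Sum>\<^sub>\<infinity>t. \<bar>(\<Sum>j<n. c ^ j * (shift ^^ j) g t) - h t\<bar>) \<longlonglongrightarrow> 0"
proof -
  define N where "N = (\<Sum>\<^sub>\<infinity>t. \<bar>g t\<bar>)"
  have gN: "\<bar>g t\<bar> \<le> N" for t
  proof -
    have "(\<Sum>\<^sub>\<infinity>s\<in>{t}. \<bar>g s\<bar>) \<le> (\<Sum>\<^sub>\<infinity>s. \<bar>g s\<bar>)"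
      using g by (intro infsum_mono_neutral) (auto simp: ell1_def)
    then show ?thesis by (simp add: N_def)
  qed
  have geo: "summable (\<lambda>j. \<bar>c\<bar> ^ j * N)"
    using c by (intro summable_mult2 summable_geometric) auto
  have sa: "summable (\<lambda>j. \<bar>c ^ j * g (t + int j)\<bar>)" for t
    by (rule summable_comparison_test[OF _ geo])
       (auto simp: abs_mult power_abs intro!: exI[of _ 0] mult_left_mono gN)
  show s: "summable (\<lambda>j. c ^ j * g (t + int j))" for t
    by (rule summable_rabs_cancel[OF sa])
  show "h t - c * shift h t = g t" for t
  proof -
    have "h t = g t + (\<Sum>j. c ^ Suc j * g (t + int (Suc j)))"
      using suminf_split_head[OF s, of t] by (simp add: h_def)
    also have "(\<Sum>j. c ^ Suc j * g (t + int (Suc j))) = (\<Sum>j. c * (c ^ j * g ((t + 1) + int j)))"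
      by (simp add: algebra_simps)
    also have "\<dots> = c * shift h t"
      using suminf_mult[OF s] by (simp add: h_def shift_def)
    finally show ?thesis by simp
  qed
  have tail: "(\<Sum>t\<in>F. \<bar>(\<Sum>j<n. c ^ j * (shift ^^ j) g t) - h t\<bar>) \<le> \<bar>c\<bar> ^ n * N / (1 - \<bar>c\<bar>)"
    if F: "finite F" for F n
  proof -
    have sn: "summable (\<lambda>j. \<bar>c ^ (j + n) * g (t + int (j + n))\<bar>)" for t
      using summable_ignore_initial_segment[OF sa, of n t] by simp
    have "(\<Sum>t\<in>F. \<bar>(\<Sum>j<n. c ^ j * (shift ^^ j) g t) - h t\<bar>)
        \<le> (\<Sum>t\<in>F. \<Sum>j. \<bar>c ^ (j + n) * g (t + int (j + n))\<bar>)"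
    proof (rule sum_mono)
      fix t
      have "h t = (\<Sum>j. c ^ (j + n) * g (t + int (j + n))) + (\<Sum>j<n. c ^ j * g (t + int j))"
        using suminf_split_initial_segment[OF s, of t n] by (simp add: h_def)
      then show "\<bar>(\<Sum>j<n. c ^ j * (shift ^^ j) g t) - h t\<bar>
          \<le> (\<Sum>j. \<bar>c ^ (j + n) * g (t + int (j + n))\<bar>)"
        using summable_rabs[OF sn, of t] by (simp add: shift_power)
    qed
    also have "\<dots> = (\<Sum>j. \<Sum>t\<in>F. \<bar>c ^ (j + n) * g (t + int (j + n))\<bar>)"
      by (rule suminf_sum[symmetric]) (rule sn)
    also have "\<dots> \<le> (\<Sum>j. \<bar>c\<bar> ^ j * (\<bar>c\<bar> ^ n * N))"
    proof (rule suminf_le)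
      fix j
      have "(\<Sum>t\<in>F. \<bar>g (t + int (j + n))\<bar>) \<le> N"
        using finite_sum_le_infsum[OF ell1_shift_power(1)[OF g] F, of "int (j + n)"]
          ell1_shift_power(2)[OF g] by (simp add: N_def)
      then have "\<bar>c\<bar> ^ (j + n) * (\<Sum>t\<in>F. \<bar>g (t + int (j + n))\<bar>) \<le> \<bar>c\<bar> ^ (j + n) * N"
        by (intro mult_left_mono) auto
      then show "(\<Sum>t\<in>F. \<bar>c ^ (j + n) * g (t + int (j + n))\<bar>) \<le> \<bar>c\<bar> ^ j * (\<bar>c\<bar> ^ n * N)"
        by (simp add: sum_distrib_left abs_mult power_abs power_add mult_ac)
    next
      show "summable (\<lambda>j. \<Sum>t\<in>F. \<bar>c ^ (j + n) * g (t + int (j + n))\<bar>)"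
        by (rule summable_sum) (rule sn)
      show "summable (\<lambda>j. \<bar>c\<bar> ^ j * (\<bar>c\<bar> ^ n * N))"
        using c by (intro summable_mult2 summable_geometric) auto
    qed
    also have "\<dots> = \<bar>c\<bar> ^ n * N / (1 - \<bar>c\<bar>)"
      using c suminf_mult2[of "\<lambda>j. \<bar>c\<bar> ^ j" "\<bar>c\<bar> ^ n * N"] suminf_geometric[of "\<bar>c\<bar>"]
      by (simp add: summable_geometric)
    finally show ?thesis .
  qed
  have ts: "(\<lambda>t. \<bar>(\<Sum>j<n. c ^ j * (shift ^^ j) g t) - h t\<bar>) summable_on UNIV" for n
    by (intro nonneg_bdd_above_summable_on bdd_aboveI[of _ "\<bar>c\<bar> ^ n * N / (1 - \<bar>c\<bar>)"])
       (use tail in auto)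
  show "h \<in> ell1"
    using ts[of 0] by (simp add: ell1_def)
  show "(\<lambda>n. \<Sum>\<^sub>\<infinity>t. \<bar>(\<Sum>j<n. c ^ j * (shift ^^ j) g t) - h t\<bar>) \<longlonglongrightarrow> 0"
  proof (rule tendsto_sandwich[OF _ _ tendsto_const])
    show "\<forall>\<^sub>F n in sequentially. 0 \<le> (\<Sum>\<^sub>\<infinity>t. \<bar>(\<Sum>j<n. c ^ j * (shift ^^ j) g t) - h t\<bar>)"
      by (simp add: infsum_nonneg)
    show "\<forall>\<^sub>F n in sequentially. (\<Sum>\<^sub>\<infinity>t. \<bar>(\<Sum>j<n. c ^ j * (shift ^^ j) g t) - h t\<bar>)
        \<le> \<bar>c\<bar> ^ n * (N / (1 - \<bar>c\<bar>))"
      by (intro always_eventually allI infsum_le_finite_sums ts) (use tail in auto)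
    show "(\<lambda>n. \<bar>c\<bar> ^ n * (N / (1 - \<bar>c\<bar>))) \<longlonglongrightarrow> 0"
      using c by (intro tendsto_mult_left_zero LIMSEQ_power_zero) auto
  qed
qed

lemma bij_betw_id_minus_shift:
  assumes c: "\<bar>c\<bar> < 1"
  shows "bij_betw (\<lambda>h t. h t - c * shift h t) ell1 ell1"
proof -
  have maps: "(\<lambda>t. h t - c * shift h t) \<in> ell1" if "h \<in> ell1" for h
  proof -
    have "(\<lambda>t. \<bar>h t\<bar> + \<bar>c\<bar> * \<bar>h (t + 1)\<bar>) summable_on UNIV"
      using that ell1_shift_power(1)[OF that, of 1]
      by (intro summable_on_add summable_on_cmult_right) (auto simp: ell1_def)
    then have "(\<lambda>t. norm (h t - c * shift h t)) summable_on UNIV"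
    proof (rule Infinite_Sum.abs_summable_on_comparison_test')
      fix t :: int
      show "norm (h t - c * shift h t) \<le> \<bar>h t\<bar> + \<bar>c\<bar> * \<bar>h (t + 1)\<bar>"
        using abs_triangle_ineq4[of "h t" "c * h (t + 1)"] by (simp add: shift_def abs_mult)
    qed
    then show ?thesis by (simp add: ell1_def)
  qed
  have inj: "inj_on (\<lambda>h t. h t - c * shift h t) ell1"
  proof (rule inj_onI)
    fix h k assume hk: "h \<in> ell1" "k \<in> ell1"
      and eq: "(\<lambda>t. h t - c * shift h t) = (\<lambda>t. k t - c * shift k t)"
    define d where "d = (\<lambda>t. h t - k t)"
    have step: "d t = c * d (t + 1)" for t
      using fun_cong[OF eq, of t] by (simp add: d_def shift_def algebra_simps)
    have it: "d t = c ^ n * d (t + int n)" for t n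
    proof (induction n)
      case (Suc n)
      then show ?case
        using step[of "t + int n"] by (simp add: algebra_simps)
    qed simp
    have bdd: "\<exists>N. \<forall>t. \<bar>u t\<bar> \<le> N" if "u \<in> ell1" for u
    proof (intro exI allI)
      fix t
      have "(\<Sum>\<^sub>\<infinity>s\<in>{t}. \<bar>u s\<bar>) \<le> (\<Sum>\<^sub>\<infinity>s. \<bar>u s\<bar>)"
        using that by (intro infsum_mono_neutral) (auto simp: ell1_def)
      then show "\<bar>u t\<bar> \<le> (\<Sum>\<^sub>\<infinity>s. \<bar>u s\<bar>)" by simp
    qed
    obtain N1 N2 where N: "\<And>t. \<bar>h t\<bar> \<le> N1" "\<And>t. \<bar>k t\<bar> \<le> N2"
      using bdd hk by metis
    have dN: "\<bar>d t\<bar> \<le> N1 + N2" for t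
      using N(1)[of t] N(2)[of t] unfolding d_def by linarith
    have "d t = 0" for t
    proof -
      have "\<bar>d t\<bar> \<le> \<bar>c\<bar> ^ n * (N1 + N2)" for n
        by (subst it[of t n]) (auto simp: abs_mult power_abs intro!: mult_left_mono dN)
      moreover have "(\<lambda>n. \<bar>c\<bar> ^ n * (N1 + N2)) \<longlonglongrightarrow> 0"
        using c by (intro tendsto_mult_left_zero LIMSEQ_power_zero) auto
      ultimately have "\<bar>d t\<bar> \<le> 0"
        using LIMSEQ_le_const by blast
      then show ?thesis by simp
    qed
    then show "h = k" by (auto simp: d_def)
  qed
  have "(\<lambda>h t. h t - c * shift h t) ` ell1 = ell1"
  proof
    show "(\<lambda>h t. h t - c * shift h t) ` ell1 \<subseteq> ell1" using maps by auto
    show "ell1 \<subseteq> (\<lambda>h t. h t - c * shift h t) ` ell1"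
    proof
      fix g assume g: "g \<in> ell1"
      show "g \<in> (\<lambda>h t. h t - c * shift h t) ` ell1"
        by (rule image_eqI[OF _ neumann_aux(3)[OF c g]]) (use neumann_aux(2)[OF c g] in auto)
    qed
  qed
  with inj show ?thesis by (simp add: bij_betw_def)
qed

lemma inv_id_minus_shift_eq:
  assumes c: "\<bar>c\<bar> < 1" and g: "g \<in> ell1"
  shows "inv_id_minus_shift c g = (\<lambda>t. \<Sum>j. c ^ j * g (t + int j))"
  unfolding inv_id_minus_shift_def
  using bij_betw_id_minus_shift[OF c] neumann_aux(2,3)[OF c g]
  by (intro the_inv_into_f_eq) (auto simp: bij_betw_def)

lemma neumann_series:
  assumes "\<bar>c\<bar> < 1" and "g \<in> ell1"
  shows "inv_id_minus_shift c g \<in> ell1"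
    and "(\<lambda>n. \<Sum>\<^sub>\<infinity>t. \<bar>(\<Sum>j<n. c ^ j * (shift ^^ j) g t) - inv_id_minus_shift c g t\<bar>) \<longlonglongrightarrow> 0"
  using neumann_aux(3,4)[OF assms] by (simp_all add: inv_id_minus_shift_eq[OF assms])

lemma has_L1_sum_suminf:
  fixes F :: "nat \<Rightarrow> 'a \<Rightarrow> real"
  assumes int: "\<And>k. integrable M (F k)" and sm: "summable (\<lambda>k. \<integral>\<omega>. \<bar>F k \<omega>\<bar> \<partial>M)"
  shows "AE \<omega> in M. summable (\<lambda>k. \<bar>F k \<omega>\<bar>)"
    and "has_L1_sum M F UNIV (\<lambda>\<omega>. \<Sum>k. F k \<omega>)"
    and "(\<integral>\<omega>. \<bar>\<Sum>k. F k \<omega>\<bar> \<partial>M) \<le> (\<Sum>k. \<integral>\<omega>. \<bar>F k \<omega>\<bar> \<partial>M)"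
proof -
  have [measurable]: "F k \<in> borel_measurable M" for k using int by auto
  have "(\<integral>\<^sup>+\<omega>. (\<Sum>k. ennreal \<bar>F k \<omega>\<bar>) \<partial>M) = (\<Sum>k. \<integral>\<^sup>+\<omega>. ennreal \<bar>F k \<omega>\<bar> \<partial>M)"
    by (intro nn_integral_suminf) auto
  also have "\<dots> = (\<Sum>k. ennreal (\<integral>\<omega>. \<bar>F k \<omega>\<bar> \<partial>M))"
    using int by (intro arg_cong[where f=suminf] ext nn_integral_eq_integral) auto
  also have "\<dots> \<noteq> top"
    by (intro ennreal_suminf_neq_top sm) auto
  finally have "AE \<omega> in M. (\<Sum>k. ennreal \<bar>F k \<omega>\<bar>) \<noteq> \<infinity>"
    by (intro nn_integral_PInf_AE) auto
  then show ae: "AE \<omega> in M. summable (\<lambda>k. \<bar>F k \<omega>\<bar>)"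
    by eventually_elim (auto intro: summable_suminf_not_top)
  have intS: "integrable M (\<lambda>\<omega>. \<Sum>k. F k \<omega>)"
    using int ae sm by (intro integrable_suminf) auto
  have intD: "integrable M (\<lambda>\<omega>. \<Sum>k. \<bar>F k \<omega>\<bar>)"
    and D: "(\<integral>\<omega>. (\<Sum>k. \<bar>F k \<omega>\<bar>) \<partial>M) = (\<Sum>k. \<integral>\<omega>. \<bar>F k \<omega>\<bar> \<partial>M)"
    using int ae sm by (intro integrable_suminf integral_suminf; auto)+
  have "(\<integral>\<omega>. \<bar>\<Sum>k. F k \<omega>\<bar> \<partial>M) \<le> (\<integral>\<omega>. (\<Sum>k. \<bar>F k \<omega>\<bar>) \<partial>M)"
    using intS intD ae by (intro integral_mono_AE) (auto elim!: eventually_mono intro: summable_rabs)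
  then show "(\<integral>\<omega>. \<bar>\<Sum>k. F k \<omega>\<bar> \<partial>M) \<le> (\<Sum>k. \<integral>\<omega>. \<bar>F k \<omega>\<bar> \<partial>M)"
    by (simp add: D)
  have bound: "(\<integral>\<omega>. \<bar>(\<Sum>k\<in>I. F k \<omega>) - (\<Sum>k. F k \<omega>)\<bar> \<partial>M)
      \<le> (\<Sum>k. \<integral>\<omega>. \<bar>F k \<omega>\<bar> \<partial>M) - (\<Sum>k\<in>I. \<integral>\<omega>. \<bar>F k \<omega>\<bar> \<partial>M)"
    if I: "finite I" for I
  proof -
    have "(\<integral>\<omega>. \<bar>(\<Sum>k\<in>I. F k \<omega>) - (\<Sum>k. F k \<omega>)\<bar> \<partial>M)
        \<le> (\<integral>\<omega>. (\<Sum>k. \<bar>F k \<omega>\<bar>) - (\<Sum>k\<in>I. \<bar>F k \<omega>\<bar>) \<partial>M)"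
    proof (rule integral_mono_AE)
      show "integrable M (\<lambda>\<omega>. \<bar>(\<Sum>k\<in>I. F k \<omega>) - (\<Sum>k. F k \<omega>)\<bar>)"
        using int intS by auto
      show "integrable M (\<lambda>\<omega>. (\<Sum>k. \<bar>F k \<omega>\<bar>) - (\<Sum>k\<in>I. \<bar>F k \<omega>\<bar>))"
        using int intD by auto
      show "AE \<omega> in M. \<bar>(\<Sum>k\<in>I. F k \<omega>) - (\<Sum>k. F k \<omega>)\<bar>
          \<le> (\<Sum>k. \<bar>F k \<omega>\<bar>) - (\<Sum>k\<in>I. \<bar>F k \<omega>\<bar>)"
        using ae
      proof eventually_elim
        case (elim \<omega>)
        let ?G = "\<lambda>k. if k \<in> I then 0 else F k \<omega>"
        have f: "(\<lambda>k. if k \<in> I then F k \<omega> else 0) sums (\<Sum>k\<in>I. F k \<omega>)"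
          and f': "(\<lambda>k. if k \<in> I then \<bar>F k \<omega>\<bar> else 0) sums (\<Sum>k\<in>I. \<bar>F k \<omega>\<bar>)"
          by (rule sums_If_finite_set[OF I])+
        have s: "(\<lambda>k. F k \<omega>) sums (\<Sum>k. F k \<omega>)"
          using summable_rabs_cancel[OF elim] by (rule summable_sums)
        have "?G = (\<lambda>k. F k \<omega> - (if k \<in> I then F k \<omega> else 0))" by auto
        then have a: "?G sums ((\<Sum>k. F k \<omega>) - (\<Sum>k\<in>I. F k \<omega>))"
          using sums_diff[OF s f] by (simp only:)
        have "(\<lambda>k. \<bar>?G k\<bar>) = (\<lambda>k. \<bar>F k \<omega>\<bar> - (if k \<in> I then \<bar>F k \<omega>\<bar> else 0))" by auto
        then have b: "(\<lambda>k. \<bar>?G k\<bar>) sums ((\<Sum>k. \<bar>F k \<omega>\<bar>) - (\<Sum>k\<in>I. \<bar>F k \<omega>\<bar>))"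
          using sums_diff[OF summable_sums[OF elim] f'] by (simp only:)
        show ?case
          using summable_rabs[OF sums_summable[OF b]] sums_unique[OF a] sums_unique[OF b] by auto
      qed
    qed
    also have "\<dots> = (\<Sum>k. \<integral>\<omega>. \<bar>F k \<omega>\<bar> \<partial>M) - (\<Sum>k\<in>I. \<integral>\<omega>. \<bar>F k \<omega>\<bar> \<partial>M)"
      using int intD by (simp add: D)
    finally show ?thesis .
  qed
  have "((\<lambda>k. \<integral>\<omega>. \<bar>F k \<omega>\<bar> \<partial>M) has_sum (\<Sum>k. \<integral>\<omega>. \<bar>F k \<omega>\<bar> \<partial>M)) UNIV"
    using sm by (intro norm_summable_imp_has_sum) (auto intro: summable_sums)
  then have "((\<lambda>I. (\<Sum>k. \<integral>\<omega>. \<bar>F k \<omega>\<bar> \<partial>M) - (\<Sum>k\<in>I. \<integral>\<omega>. \<bar>F k \<omega>\<bar> \<partial>M)) \<longlongrightarrow> 0)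
      (finite_subsets_at_top UNIV)"
    unfolding has_sum_def by (auto intro!: tendsto_eq_intros)
  then have "((\<lambda>I. \<integral>\<omega>. \<bar>(\<Sum>k\<in>I. F k \<omega>) - (\<Sum>k. F k \<omega>)\<bar> \<partial>M) \<longlongrightarrow> 0)
      (finite_subsets_at_top UNIV)"
    by (rule tendsto_sandwich[OF _ _ tendsto_const, rotated -1])
       (auto intro!: eventually_finite_subsets_at_top_weakI bound)
  then show "has_L1_sum M F UNIV (\<lambda>\<omega>. \<Sum>k. F k \<omega>)"
    using int intS by (simp add: has_L1_sum_def)
qed

lemma ar1_solution_exists:
  assumes c: "\<bar>c\<bar> < 1" and int: "\<And>t. integrable M (U t)"
    and B: "\<And>t. (\<integral>\<omega>. \<bar>U t \<omega>\<bar> \<partial>M) \<le> B"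
  shows "\<exists>Z. ar1_solution M c U Z \<and> (\<forall>t. (\<integral>\<omega>. \<bar>Z t \<omega>\<bar> \<partial>M) \<le> B / (1 - \<bar>c\<bar>))"
proof -
  define F where "F = (\<lambda>t k \<omega>. c ^ k * U (t - int k) \<omega>)"
  define Z where "Z = (\<lambda>t \<omega>. \<Sum>k. F (t - 1) k \<omega>)"
  have i: "integrable M (F t k)" for t k using int by (simp add: F_def)
  have le: "(\<integral>\<omega>. \<bar>F t k \<omega>\<bar> \<partial>M) \<le> \<bar>c\<bar> ^ k * B" for t k
    using mult_left_mono[OF B, of "\<bar>c\<bar> ^ k" "t - int k"] by (simp add: F_def abs_mult power_abs)
  have geo: "summable (\<lambda>k. \<bar>c\<bar> ^ k * B)"
    using c by (intro summable_mult2 summable_geometric) auto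
  have s: "summable (\<lambda>k. \<integral>\<omega>. \<bar>F t k \<omega>\<bar> \<partial>M)" for t
    by (rule summable_comparison_test[OF _ geo]) (use le in auto)
  note L = has_L1_sum_suminf[OF i s]
  have "ar1_solution M c U Z"
    unfolding ar1_solution_def
  proof (intro conjI allI)
    fix t
    show "has_L1_sum M (\<lambda>k \<omega>. c ^ k * U (t - int k) \<omega>) UNIV (Z (t + 1))"
      using L(2)[of t] by (simp add: F_def Z_def)
    show "AE \<omega> in M. Z (t + 1) \<omega> = c * Z t \<omega> + U t \<omega>"
      using L(1)[of t] L(1)[of "t - 1"]
    proof eventually_elim
      case (elim \<omega>)
      have "Z (t + 1) \<omega> = U t \<omega> + (\<Sum>k. F t (Suc k) \<omega>)"
        using suminf_split_head[OF summable_rabs_cancel[OF elim(1)]] by (simp add: Z_def F_def)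
      also have "(\<Sum>k. F t (Suc k) \<omega>) = (\<Sum>k. c * F (t - 1) k \<omega>)"
        by (simp add: F_def algebra_simps)
      also have "\<dots> = c * Z t \<omega>"
        using suminf_mult[OF summable_rabs_cancel[OF elim(2)]] by (simp add: Z_def)
      finally show ?case by simp
    qed
  qed
  moreover have "(\<integral>\<omega>. \<bar>Z t \<omega>\<bar> \<partial>M) \<le> B / (1 - \<bar>c\<bar>)" for t
  proof -
    have "(\<integral>\<omega>. \<bar>Z t \<omega>\<bar> \<partial>M) \<le> (\<Sum>k. \<integral>\<omega>. \<bar>F (t - 1) k \<omega>\<bar> \<partial>M)"
      using L(3)[of "t - 1"] by (simp add: Z_def)
    also have "\<dots> \<le> (\<Sum>k. \<bar>c\<bar> ^ k * B)"
      by (intro suminf_le le s geo)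
    also have "\<dots> = B / (1 - \<bar>c\<bar>)"
      using c suminf_mult2[of "\<lambda>j. \<bar>c\<bar> ^ j" B] suminf_geometric[of "\<bar>c\<bar>"]
      by (simp add: summable_geometric)
    finally show ?thesis .
  qed
  ultimately show ?thesis by blast
qed

lemma ar1_solution_integrable:
  assumes "ar1_solution M c U Z"
  shows "integrable M (Z t)"
proof -
  have "integrable M (Z ((t - 1) + 1))"
    using assms unfolding ar1_solution_def has_L1_sum_def by blast
  then show ?thesis by simp
qed

lemma std_normal_L1:
  assumes "prob_space M" "distributed M lborel E std_normal_density"
  shows "integrable M E" "(\<integral>\<omega>. \<bar>E \<omega>\<bar> \<partial>M) = (\<integral>x. std_normal_density x * \<bar>x\<bar> \<partial>lborel)"
proof -
  have "integrable lborel (\<lambda>x. std_normal_density x * x)"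
    using integrable_std_normal_moment[of 1] by simp
  then show "integrable M E"
    using distributed_integrable[OF assms(2), of "\<lambda>x. x"] by simp
  show "(\<integral>\<omega>. \<bar>E \<omega>\<bar> \<partial>M) = (\<integral>x. std_normal_density x * \<bar>x\<bar> \<partial>lborel)"
    using distributed_integral[OF assms(2), of "\<lambda>x. \<bar>x\<bar>"] by simp
qed

lemma stationary_solution_exists:
  assumes M: "prob_space M" and E: "jointly_iid_std_normal M eX eY"
    and "\<bar>\<alpha>\<bar> < 1" "\<bar>\<gamma>\<bar> < 1"
  shows "\<exists>X Y. stationary_solution M \<alpha> \<beta> \<gamma> eX eY X Y"
proof -
  define C where "C = (\<integral>x. std_normal_density x * \<bar>x\<bar> \<partial>lborel)"
  note eX = std_normal_L1[OF M E[unfolded jointly_iid_std_normal_def, THEN conjunct2,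
        THEN conjunct1, rule_format], folded C_def]
  note eY = std_normal_L1[OF M E[unfolded jointly_iid_std_normal_def, THEN conjunct2,
        THEN conjunct2, rule_format], folded C_def]
  obtain X where X: "ar1_solution M \<alpha> eX X"
    and XB: "\<And>t. (\<integral>\<omega>. \<bar>X t \<omega>\<bar> \<partial>M) \<le> C / (1 - \<bar>\<alpha>\<bar>)"
    using ar1_solution_exists[of \<alpha> M eX C] assms eX by auto
  have Xi: "integrable M (X t)" for t by (rule ar1_solution_integrable[OF X])
  have "(\<integral>\<omega>. \<bar>\<beta> * X t \<omega> + eY t \<omega>\<bar> \<partial>M) \<le> \<bar>\<beta>\<bar> * (C / (1 - \<bar>\<alpha>\<bar>)) + C" for t
  proof -
    have "(\<integral>\<omega>. \<bar>\<beta> * X t \<omega> + eY t \<omega>\<bar> \<partial>M) \<le> (\<integral>\<omega>. \<bar>\<beta>\<bar> * \<bar>X t \<omega>\<bar> + \<bar>eY t \<omega>\<bar> \<partial>M)"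
      using Xi eY(1)
      by (intro integral_mono) (auto simp: abs_mult[symmetric] intro: abs_triangle_ineq)
    also have "\<dots> = \<bar>\<beta>\<bar> * (\<integral>\<omega>. \<bar>X t \<omega>\<bar> \<partial>M) + C"
      using Xi eY by simp
    also have "\<dots> \<le> \<bar>\<beta>\<bar> * (C / (1 - \<bar>\<alpha>\<bar>)) + C"
      by (intro add_right_mono mult_left_mono XB) auto
    finally show ?thesis .
  qed
  note B = this
  have "integrable M (\<lambda>\<omega>. \<beta> * X t \<omega> + eY t \<omega>)" for t
    using Xi eY(1) by auto
  from ar1_solution_exists[where U="\<lambda>t \<omega>. \<beta> * X t \<omega> + eY t \<omega>",
      OF \<open>\<bar>\<gamma>\<bar> < 1\<close> this B]
  obtain Y where "ar1_solution M \<gamma> (\<lambda>t \<omega>. \<beta> * X t \<omega> + eY t \<omega>) Y" by blast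
  with X show ?thesis by (auto simp: stationary_solution_def)
qed

lemma do_solution_exists:
  assumes M: "prob_space M" and E: "jointly_iid_std_normal M eX eY"
    and "\<bar>\<gamma>\<bar> < 1" and xs: "bounded (range xs)"
  shows "\<exists>Ydo. do_solution M \<beta> \<gamma> eY xs Ydo"
proof -
  interpret prob_space M by (rule M)
  define C where "C = (\<integral>x. std_normal_density x * \<bar>x\<bar> \<partial>lborel)"
  note eY = std_normal_L1[OF M E[unfolded jointly_iid_std_normal_def, THEN conjunct2,
        THEN conjunct2, rule_format], folded C_def]
  obtain b where b: "\<And>t. \<bar>xs t\<bar> \<le> b"
    using xs by (auto simp: bounded_iff)
  have "(\<integral>\<omega>. \<bar>\<beta> * xs t + eY t \<omega>\<bar> \<partial>M) \<le> \<bar>\<beta>\<bar> * b + C" for t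
  proof -
    have "(\<integral>\<omega>. \<bar>\<beta> * xs t + eY t \<omega>\<bar> \<partial>M) \<le> (\<integral>\<omega>. \<bar>\<beta>\<bar> * \<bar>xs t\<bar> + \<bar>eY t \<omega>\<bar> \<partial>M)"
      using eY(1)
      by (intro integral_mono) (auto simp: abs_mult[symmetric] intro: abs_triangle_ineq)
    also have "\<dots> = \<bar>\<beta>\<bar> * \<bar>xs t\<bar> + C"
      using eY by (simp add: prob_space)
    also have "\<dots> \<le> \<bar>\<beta>\<bar> * b + C"
      by (intro add_right_mono mult_left_mono b) auto
    finally show ?thesis .
  qed
  note B = this
  have "integrable M (\<lambda>\<omega>. \<beta> * xs t + eY t \<omega>)" for t
    using eY(1) by auto
  from ar1_solution_exists[where U="\<lambda>t \<omega>. \<beta> * xs t + eY t \<omega>",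
      OF \<open>\<bar>\<gamma>\<bar> < 1\<close> this B] show ?thesis
    unfolding do_solution_def by blast
qed

end

theory Submission
  imports Defs
begin

text \<open>
  Let \<open>Z\<close> be autoregressive with parameter \<open>c\<close> and innovations \<open>U\<close>. Inserting its backward series into
  \<open>\<Sum> h(t) Z(t)\<close> and reordering gives \<open>\<Sum> a(s) U(s)\<close> with \<open>a = S (I - c S)\<^sup>-\<^sup>1 h\<close>. Hence \<open>X\<^sub>f\<close> is a series
  in the noise of \<open>X\<close> alone. For \<open>Z = Y\<close> and \<open>h = g\<close> we have \<open>f = \<beta> a\<close>, so the innovations
  \<open>\<beta> X(s) + eY(s)\<close> give \<open>Y\<^sub>g = X\<^sub>f + \<Sum> a(s) eY(s)\<close>; with constants in place of \<open>X(s)\<close> the same identity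
  covers the intervention. Series of independent Gaussian variables that converge in the mean are
  Gaussian, by convergence of characteristic functions.
\<close>

section \<open>Series in the mean\<close>

text \<open>By the triangle inequality every finite partial sum bounds the mean distance of the two
  limits by two quantities that tend to zero. This tames the choice made in \<open>L1_sum\<close>:
  any two admissible versions agree almost everywhere.\<close>

lemma has_L1_sum_unique:
  assumes L: "has_L1_sum M F A L" and L': "has_L1_sum M F A L'"
  shows "AE \<omega> in M. L \<omega> = L' \<omega>"
proof -
  have int: "\<And>i. i \<in> A \<Longrightarrow> integrable M (F i)" "integrable M L" "integrable M L'"
    and lim: "((\<lambda>I. \<integral>\<omega>. \<bar>(\<Sum>i\<in>I. F i \<omega>) - L \<omega>\<bar> \<partial>M) \<longlongrightarrow> 0) (finite_subsets_at_top A)"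
      "((\<lambda>I. \<integral>\<omega>. \<bar>(\<Sum>i\<in>I. F i \<omega>) - L' \<omega>\<bar> \<partial>M) \<longlongrightarrow> 0) (finite_subsets_at_top A)"
    using L L' by (auto simp: has_L1_sum_def)
  have "(\<integral>\<omega>. \<bar>L \<omega> - L' \<omega>\<bar> \<partial>M) \<le>
      (\<integral>\<omega>. \<bar>(\<Sum>i\<in>I. F i \<omega>) - L \<omega>\<bar> \<partial>M) + (\<integral>\<omega>. \<bar>(\<Sum>i\<in>I. F i \<omega>) - L' \<omega>\<bar> \<partial>M)"
    if "finite I" "I \<subseteq> A" for I
  proof -
    have S: "integrable M (\<lambda>\<omega>. \<Sum>i\<in>I. F i \<omega>)"
      using that int by (intro Bochner_Integration.integrable_sum) auto
    have "(\<integral>\<omega>. \<bar>L \<omega> - L' \<omega>\<bar> \<partial>M) \<le>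
        (\<integral>\<omega>. \<bar>(\<Sum>i\<in>I. F i \<omega>) - L \<omega>\<bar> + \<bar>(\<Sum>i\<in>I. F i \<omega>) - L' \<omega>\<bar> \<partial>M)"
      using int S by (intro integral_mono) auto
    then show ?thesis using int S by simp
  qed
  then have "(\<integral>\<omega>. \<bar>L \<omega> - L' \<omega>\<bar> \<partial>M) \<le> 0 + 0"
    by (intro tendsto_lowerbound[OF tendsto_add[OF lim]] eventually_finite_subsets_at_top_weakI) auto
  then have "(\<integral>\<omega>. \<bar>L \<omega> - L' \<omega>\<bar> \<partial>M) = 0"
    by (simp add: order_antisym integral_nonneg_AE)
  then show ?thesis
    using int by (subst (asm) integral_nonneg_eq_0_iff_AE) auto
qed

lemma has_L1_sum_reindex:
  assumes e: "bij e" and L: "has_L1_sum M (\<lambda>n. F (e n)) UNIV L"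
  shows "has_L1_sum M F UNIV L"
proof -
  have i: "integrable M (F (e n))" for n using L by (simp add: has_L1_sum_def)
  have "integrable M (F i)" for i
    using i[of "inv e i"] e by (simp add: bij_is_surj surj_f_inv_f)
  moreover have "((\<lambda>I. \<integral>\<omega>. \<bar>(\<Sum>i\<in>I. F i \<omega>) - L \<omega>\<bar> \<partial>M) \<longlongrightarrow> 0) (finite_subsets_at_top UNIV)"
  proof -
    \<comment> \<open>A bijection matches the finite subsets of the two index types, inclusions
      included, so both nets of partial sums are the same.\<close>
    have "(finite_subsets_at_top UNIV) = filtermap ((`) e) (finite_subsets_at_top UNIV)"
      using filtermap_image_finite_subsets_at_top[of e UNIV] e by (simp add: bij_def)
    moreover have "(\<Sum>i\<in>e ` I. F i \<omega>) = (\<Sum>n\<in>I. F (e n) \<omega>)" for I \<omega>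
      using e by (intro sum.reindex_cong[of e]) (auto simp: bij_def inj_on_def)
    ultimately show ?thesis
      using L by (simp add: has_L1_sum_def filterlim_filtermap)
  qed
  ultimately show ?thesis using L by (simp add: has_L1_sum_def)
qed

lemma bij_from_nat_into: "infinite (UNIV :: 'i::countable set) \<Longrightarrow> bij (from_nat_into (UNIV :: 'i set))"
  by (rule bij_betw_from_nat_into) auto

text \<open>An enumeration reduces a countable index type to series over \<open>nat\<close>. The
  almost sure \<open>has_sum\<close> is unconditional and hence allows rearrangements at each fixed
  \<open>\<omega>\<close>; this replaces later manipulations of limits in the mean.\<close>

lemma has_L1_sum_enumeration:
  fixes F :: "'i::countable \<Rightarrow> 'a \<Rightarrow> real"
  defines "e \<equiv> from_nat_into (UNIV :: 'i set)"
  assumes inf: "infinite (UNIV :: 'i set)"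
    and int: "\<And>i. integrable M (F i)"
    and sm: "(\<lambda>i. \<integral>\<omega>. \<bar>F i \<omega>\<bar> \<partial>M) summable_on UNIV"
  shows "has_L1_sum M F UNIV (\<lambda>\<omega>. \<Sum>n. F (e n) \<omega>)"
    and "AE \<omega> in M. ((\<lambda>i. F i \<omega>) has_sum (\<Sum>n. F (e n) \<omega>)) UNIV"
proof -
  have e: "bij e" unfolding e_def by (rule bij_from_nat_into[OF inf])
  have "(\<lambda>n. \<integral>\<omega>. \<bar>F (e n) \<omega>\<bar> \<partial>M) summable_on UNIV"
    using sm summable_on_reindex_bij_betw[OF e, of "\<lambda>i. \<integral>\<omega>. \<bar>F i \<omega>\<bar> \<partial>M"] by simp
  then have s: "summable (\<lambda>n. \<integral>\<omega>. \<bar>F (e n) \<omega>\<bar> \<partial>M)"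
    by (rule summable_on_imp_summable)
  note L = has_L1_sum_suminf[of M "\<lambda>n. F (e n)", OF int s]
  show "has_L1_sum M F UNIV (\<lambda>\<omega>. \<Sum>n. F (e n) \<omega>)"
    by (rule has_L1_sum_reindex[OF e L(2)])
  show "AE \<omega> in M. ((\<lambda>i. F i \<omega>) has_sum (\<Sum>n. F (e n) \<omega>)) UNIV"
    using L(1)
  proof eventually_elim
    case (elim \<omega>)
    then have "((\<lambda>n. F (e n) \<omega>) has_sum (\<Sum>n. F (e n) \<omega>)) UNIV"
      by (intro norm_summable_imp_has_sum) (auto intro: summable_sums summable_rabs_cancel)
    then show ?case using has_sum_reindex_bij_betw[OF e, of "\<lambda>i. F i \<omega>"] by simp
  qed
qed

text \<open>The mean norms are dominated by the summable family \<open>\<bar>h t\<bar> * B\<close>.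
  The limit is written as an explicit series along an enumeration, so that it is a measurable
  function of the variables \<open>Z t\<close>.\<close>

lemma ell1_weighted_L1:
  fixes Z :: "int \<Rightarrow> 'a \<Rightarrow> real"
  assumes h: "h \<in> ell1" and Z: "\<And>t. integrable M (Z t)" and B: "\<And>t. (\<integral>\<omega>. \<bar>Z t \<omega>\<bar> \<partial>M) \<le> B"
  shows "has_L1_sum M (\<lambda>t \<omega>. h t * Z t \<omega>) UNIV
      (\<lambda>\<omega>. \<Sum>n. h (from_nat_into UNIV n) * Z (from_nat_into UNIV n) \<omega>)"
    and "AE \<omega> in M. ((\<lambda>t. h t * Z t \<omega>) has_sum
      (\<Sum>n. h (from_nat_into UNIV n) * Z (from_nat_into UNIV n) \<omega>)) UNIV"
proof -
  have "(\<lambda>t. \<bar>h t\<bar> * B) summable_on UNIV"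
    using h by (intro summable_on_cmult_left) (simp add: ell1_def)
  then have "(\<lambda>t. \<integral>\<omega>. \<bar>h t * Z t \<omega>\<bar> \<partial>M) summable_on UNIV"
    by (rule summable_on_comparison_test)
      (auto simp: abs_mult intro!: mult_left_mono B integral_nonneg_AE)
  from has_L1_sum_enumeration[OF _ _ this] Z
  show "has_L1_sum M (\<lambda>t \<omega>. h t * Z t \<omega>) UNIV
      (\<lambda>\<omega>. \<Sum>n. h (from_nat_into UNIV n) * Z (from_nat_into UNIV n) \<omega>)"
    "AE \<omega> in M. ((\<lambda>t. h t * Z t \<omega>) has_sum
      (\<Sum>n. h (from_nat_into UNIV n) * Z (from_nat_into UNIV n) \<omega>)) UNIV"
    by auto
qed

text \<open>\<open>lin_comb\<close> is an unspecified version of the limit. It agrees almost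
  everywhere with the enumerated series and so inherits its pointwise \<open>has_sum\<close>, the
  form in which linear combinations are compared below.\<close>

lemma lin_comb_has_sum:
  fixes Z :: "int \<Rightarrow> 'a \<Rightarrow> real"
  assumes h: "h \<in> ell1" and Z: "\<And>t. integrable M (Z t)" and B: "\<And>t. (\<integral>\<omega>. \<bar>Z t \<omega>\<bar> \<partial>M) \<le> B"
  shows "has_L1_sum M (\<lambda>t \<omega>. h t * Z t \<omega>) UNIV (lin_comb M h Z)"
    and "AE \<omega> in M. ((\<lambda>t. h t * Z t \<omega>) has_sum lin_comb M h Z \<omega>) UNIV"
proof -
  note W = ell1_weighted_L1[where Z=Z, OF assms]
  show 1: "has_L1_sum M (\<lambda>t \<omega>. h t * Z t \<omega>) UNIV (lin_comb M h Z)"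
    unfolding lin_comb_def L1_sum_def by (rule someI[where P="has_L1_sum M (\<lambda>t \<omega>. h t * Z t \<omega>) UNIV", OF W(1)])
  show "AE \<omega> in M. ((\<lambda>t. h t * Z t \<omega>) has_sum lin_comb M h Z \<omega>) UNIV"
    using W(2) has_L1_sum_unique[OF W(1) 1] by eventually_elim simp
qed

section \<open>Autoregressive processes\<close>

text \<open>Any solution coincides almost everywhere with its absolutely convergent backward series.
  The geometric weights then bound its mean norm uniformly in \<open>t\<close>, as is required for
  combining it with coefficients from \<open>ell1\<close>.\<close>

lemma ar1_solution_suminf:
  assumes c: "\<bar>c\<bar> < 1" and U: "\<And>t. integrable M (U t)"
    and B: "\<And>t. (\<integral>\<omega>. \<bar>U t \<omega>\<bar> \<partial>M) \<le> B" and Z: "ar1_solution M c U Z"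
  shows "AE \<omega> in M. ((\<lambda>k. c ^ k * U (t - 1 - int k) \<omega>) has_sum Z t \<omega>) UNIV"
    and "(\<integral>\<omega>. \<bar>Z t \<omega>\<bar> \<partial>M) \<le> B / (1 - \<bar>c\<bar>)"
proof -
  define F where "F = (\<lambda>k \<omega>. c ^ k * U (t - 1 - int k) \<omega>)"
  have i: "integrable M (F k)" for k using U by (simp add: F_def)
  have le: "(\<integral>\<omega>. \<bar>F k \<omega>\<bar> \<partial>M) \<le> \<bar>c\<bar> ^ k * B" for k
    using mult_left_mono[OF B, of "\<bar>c\<bar> ^ k"] by (simp add: F_def abs_mult power_abs)
  have geo: "summable (\<lambda>k. \<bar>c\<bar> ^ k * B)"
    using c by (intro summable_mult2 summable_geometric) auto
  have s: "summable (\<lambda>k. \<integral>\<omega>. \<bar>F k \<omega>\<bar> \<partial>M)"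
    by (rule summable_comparison_test[OF _ geo]) (use le in auto)
  note L = has_L1_sum_suminf[OF i s]
  \<comment> \<open>The definition gives the series for the successor of a time, hence it is used at
    \<open>t - 1\<close>.\<close>
  have "has_L1_sum M F UNIV (Z (t - 1 + 1))"
    using Z unfolding ar1_solution_def F_def by blast
  then have eq: "AE \<omega> in M. Z t \<omega> = (\<Sum>k. F k \<omega>)"
    using has_L1_sum_unique[OF _ L(2)] by simp
  with L(1) show "AE \<omega> in M. ((\<lambda>k. c ^ k * U (t - 1 - int k) \<omega>) has_sum Z t \<omega>) UNIV"
  proof eventually_elim
    case (elim \<omega>)
    then show ?case
      using norm_summable_imp_has_sum[of "\<lambda>k. F k \<omega>" "Z t \<omega>"] summable_sums[OF summable_rabs_cancel[OF elim(1)]]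
      by (simp add: F_def)
  qed
  have "(\<integral>\<omega>. \<bar>Z t \<omega>\<bar> \<partial>M) = (\<integral>\<omega>. \<bar>\<Sum>k. F k \<omega>\<bar> \<partial>M)"
  proof (rule integral_cong_AE)
    have "integrable M (\<lambda>\<omega>. \<Sum>k. F k \<omega>)" using L(2) by (simp add: has_L1_sum_def)
    then show "(\<lambda>\<omega>. \<bar>\<Sum>k. F k \<omega>\<bar>) \<in> borel_measurable M" by auto
    show "(\<lambda>\<omega>. \<bar>Z t \<omega>\<bar>) \<in> borel_measurable M"
      using ar1_solution_integrable[OF Z] by auto
  qed (use eq in auto)
  also have "\<dots> \<le> (\<Sum>k. \<bar>c\<bar> ^ k * B)"
    by (rule order_trans[OF L(3)]) (intro suminf_le le s geo)
  also have "\<dots> = B / (1 - \<bar>c\<bar>)"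
    using c suminf_mult2[of "\<lambda>j. \<bar>c\<bar> ^ j" B] suminf_geometric[of "\<bar>c\<bar>"]
    by (simp add: summable_geometric)
  finally show "(\<integral>\<omega>. \<bar>Z t \<omega>\<bar> \<partial>M) \<le> B / (1 - \<bar>c\<bar>)" .
qed

lemma ell1_shift_iff: "(\<lambda>t. h (t + j)) \<in> ell1 \<longleftrightarrow> h \<in> ell1"
proof -
  have "bij (\<lambda>t::int. t + j)"
    by (rule bij_betwI[where g="\<lambda>t. t - j"]) auto
  from summable_on_reindex_bij_betw[OF this, of "\<lambda>t. \<bar>h t\<bar>"] show ?thesis
    by (simp add: ell1_def)
qed

lemma shift_inv_ell1: "\<bar>c\<bar> < 1 \<Longrightarrow> h \<in> ell1 \<Longrightarrow> shift (inv_id_minus_shift c h) \<in> ell1"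
  using neumann_series(1)[of c h] unfolding shift_def by (subst ell1_shift_iff)

lemma has_sum_abs_geometric: "\<bar>c :: real\<bar> < 1 \<Longrightarrow> ((\<lambda>k. \<bar>c\<bar> ^ k) has_sum (1 / (1 - \<bar>c\<bar>))) UNIV"
  by (intro norm_summable_imp_has_sum geometric_sums) (simp_all add: summable_geometric)

text \<open>Summing over \<open>k\<close> first leaves a multiple of \<open>\<bar>h t\<bar>\<close>.
  This family is the majorant behind both later interchanges of summation.\<close>

lemma geometric_ell1_summable:
  assumes c: "\<bar>c\<bar> < 1" and h: "h \<in> ell1"
  shows "(\<lambda>(t, k). \<bar>h t\<bar> * \<bar>c :: real\<bar> ^ k) summable_on (UNIV :: (int \<times> nat) set)"
proof -
  have k: "((\<lambda>k. \<bar>c\<bar> ^ k) has_sum (1 / (1 - \<bar>c\<bar>))) UNIV"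
    by (rule has_sum_abs_geometric[OF c])
  have "(\<lambda>t. \<bar>h t\<bar> * (1 / (1 - \<bar>c\<bar>))) summable_on UNIV"
    using h by (intro summable_on_cmult_left) (simp add: ell1_def)
  then have "(\<lambda>(t, k). \<bar>h t\<bar> * \<bar>c\<bar> ^ k) summable_on UNIV \<times> UNIV"
  proof (rule summable_on_SigmaI[rotated])
    show "((\<lambda>k. case (t, k) of (t, k) \<Rightarrow> \<bar>h t\<bar> * \<bar>c\<bar> ^ k) has_sum \<bar>h t\<bar> * (1 / (1 - \<bar>c\<bar>))) UNIV" for t
      unfolding prod.case by (rule has_sum_cmult_right[OF k])
  qed auto
  then show ?thesis by simp
qed

text \<open>The Neumann series evaluated at \<open>s + 1\<close>, with bounded values of
  \<open>h\<close> against geometric weights, converges absolutely. Its value is the total weight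
  that the innovation at time \<open>s\<close> receives when backward series are inserted.\<close>

lemma has_sum_shift_inv:
  assumes "\<bar>c\<bar> < 1" "h \<in> ell1"
  shows "((\<lambda>k. c ^ k * h (s + 1 + int k)) has_sum shift (inv_id_minus_shift c h) s) UNIV"
proof -
  have "(\<lambda>k. \<bar>c ^ k * h (s + 1 + int k)\<bar>) summable_on UNIV"
  proof (rule summable_on_comparison_test)
    show "(\<lambda>k. \<bar>c\<bar> ^ k * (\<Sum>\<^sub>\<infinity>t. \<bar>h t\<bar>)) summable_on UNIV"
      using has_sum_abs_geometric[OF assms(1)] by (intro summable_on_cmult_left) (auto simp: summable_on_def)
    show "\<bar>c ^ k * h (s + 1 + int k)\<bar> \<le> \<bar>c\<bar> ^ k * (\<Sum>\<^sub>\<infinity>t. \<bar>h t\<bar>)" for k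
      using finite_sum_le_infsum[of "\<lambda>t. \<bar>h t\<bar>" UNIV "{s + 1 + int k}"] assms(2)
      by (auto simp: ell1_def abs_mult power_abs intro!: mult_left_mono)
  qed auto
  then have "((\<lambda>k. c ^ k * h (s + 1 + int k)) has_sum (\<Sum>\<^sub>\<infinity>k. c ^ k * h (s + 1 + int k))) UNIV"
    unfolding real_norm_def[symmetric]
    by (intro has_sum_infsum) (rule summable_on_iff_abs_summable_on_real[THEN iffD2])
  moreover from has_sum_imp_sums[OF this]
  have "(\<Sum>\<^sub>\<infinity>k. c ^ k * h (s + 1 + int k)) = shift (inv_id_minus_shift c h) s"
    by (simp add: shift_def inv_id_minus_shift_eq[OF assms] sums_iff)
  ultimately show ?thesis by simp
qed

text \<open>Both sides are iterated sums of one family \<open>F\<close> over pairs of a time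
  \<open>t\<close> and a lag \<open>k\<close>. Its mean norms are summable, so almost surely the
  family itself is summable and may be grouped in either way.\<close>

lemma ar1_lin_comb:
  fixes U Z :: "int \<Rightarrow> 'a \<Rightarrow> real"
  assumes c: "\<bar>c\<bar> < 1" and U: "\<And>t. integrable M (U t)"
    and B: "\<And>t. (\<integral>\<omega>. \<bar>U t \<omega>\<bar> \<partial>M) \<le> B" and Z: "ar1_solution M c U Z" and h: "h \<in> ell1"
  shows "AE \<omega> in M. lin_comb M h Z \<omega> = lin_comb M (shift (inv_id_minus_shift c h)) U \<omega>"
proof -
  define a where "a = shift (inv_id_minus_shift c h)"
  define F where "F = (\<lambda>(t, k) \<omega>. h t * (c ^ k * U (t - 1 - int k) \<omega>))"
  have "(\<lambda>p. (case p of (t, k) \<Rightarrow> \<bar>h t\<bar> * \<bar>c\<bar> ^ k) * B) summable_on UNIV"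
    by (intro summable_on_cmult_left geometric_ell1_summable c h)
  then have "(\<lambda>p. \<integral>\<omega>. \<bar>F p \<omega>\<bar> \<partial>M) summable_on UNIV"
  proof (rule summable_on_comparison_test)
    show "(\<integral>\<omega>. \<bar>F p \<omega>\<bar> \<partial>M) \<le> (case p of (t, k) \<Rightarrow> \<bar>h t\<bar> * \<bar>c\<bar> ^ k) * B" for p
      by (auto simp: F_def abs_mult power_abs mult.assoc split: prod.split intro!: mult_left_mono B)
  qed auto
  moreover have "integrable M (F p)" for p
    using U by (auto simp: F_def split: prod.split)
  ultimately have F: "AE \<omega> in M. \<exists>S. ((\<lambda>p. F p \<omega>) has_sum S) UNIV"
    using has_L1_sum_enumeration(2)[of M F] by (auto simp: finite_prod elim: eventually_mono)
  have ZB: "\<And>t. integrable M (Z t)" "\<And>t. (\<integral>\<omega>. \<bar>Z t \<omega>\<bar> \<partial>M) \<le> B / (1 - \<bar>c\<bar>)"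
    using ar1_solution_integrable[OF Z] ar1_solution_suminf(2)[OF c U B Z] by auto
  have a: "a \<in> ell1" unfolding a_def by (rule shift_inv_ell1[OF c h])
  \<comment> \<open>There are countably many times, so one null set serves all of them.\<close>
  have "AE \<omega> in M. \<forall>t. ((\<lambda>k. c ^ k * U (t - 1 - int k) \<omega>) has_sum Z t \<omega>) UNIV"
    using ar1_solution_suminf(1)[OF c U B Z] by (simp add: AE_all_countable)
  then have "AE \<omega> in M. lin_comb M h Z \<omega> = lin_comb M a U \<omega>"
    using F lin_comb_has_sum(2)[where Z=Z, OF h ZB] lin_comb_has_sum(2)[where Z=U, OF a U B]
  proof eventually_elim
    case (elim \<omega>)
    then obtain S where S: "((\<lambda>p. F p \<omega>) has_sum S) (UNIV \<times> UNIV)" by auto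
    have "((\<lambda>t. h t * Z t \<omega>) has_sum S) UNIV"
      by (rule has_sum_Sigma'[OF S])
        (unfold F_def prod.case, rule has_sum_cmult_right[OF elim(1)[rule_format]])
    then have 1: "S = lin_comb M h Z \<omega>"
      using elim(3) by (rule has_sum_unique)
    \<comment> \<open>The substitution \<open>t = s + 1 + k\<close> regroups the pairs by the time
      \<open>s\<close> of the innovation.\<close>
    have "bij (\<lambda>(s, k). (s + 1 + int k, k))"
      by (rule bij_betwI[where g="\<lambda>(t, k). (t - 1 - int k, k)"]) auto
    from has_sum_reindex_bij_betw[OF this, of "\<lambda>p. F p \<omega>" S] S
    have S': "((\<lambda>(s, k). (c ^ k * h (s + 1 + int k)) * U s \<omega>) has_sum S) (UNIV \<times> UNIV)"
      by (simp add: F_def case_prod_unfold mult_ac)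
    have "((\<lambda>s. a s * U s \<omega>) has_sum S) UNIV"
      unfolding a_def
      by (rule has_sum_Sigma'[OF S']) (unfold prod.case, rule has_sum_cmult_left[OF has_sum_shift_inv[OF c h]])
    then have "S = lin_comb M a U \<omega>"
      using elim(4) by (rule has_sum_unique)
    with 1 show ?case by simp
  qed
  then show ?thesis by (simp add: a_def)
qed

text \<open>For fixed \<open>t\<close> the double sum is the product of two copies of the series for
  \<open>a (t - 1)\<close>, hence its square. This turns the variance formula of the theorem into
  the sum of squared noise coefficients, the natural variance of a series of independent standard
  normals.\<close>

lemma sum_shift_inv_squared:
  assumes c: "\<bar>c\<bar> < 1" and h: "h \<in> ell1"
  defines "a \<equiv> shift (inv_id_minus_shift c h)"
  shows "(\<lambda>(t::int, k::nat, k'::nat). c ^ (k + k') * h (t + int k') * h (t + int k))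
      summable_on UNIV"
    and "((\<lambda>t. (a t)\<^sup>2) has_sum
      (\<Sum>\<^sub>\<infinity>t. \<Sum>\<^sub>\<infinity>(k::nat, k'::nat). c ^ (k + k') * h (t + int k') * h (t + int k))) UNIV"
proof -
  define N where "N = (\<Sum>\<^sub>\<infinity>t. \<bar>h t\<bar>)"
  define P where "P = (\<lambda>(t::int, k::nat, k'::nat). c ^ (k + k') * h (t + int k') * h (t + int k))"
  have hN: "\<bar>h t\<bar> \<le> N" for t
    using finite_sum_le_infsum[of "\<lambda>t. \<bar>h t\<bar>" UNIV "{t}"] h by (auto simp: ell1_def N_def)
  have gs: "((\<lambda>k. \<bar>c\<bar> ^ k) has_sum (1 / (1 - \<bar>c\<bar>))) UNIV"
    by (rule has_sum_abs_geometric[OF c])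
  \<comment> \<open>Of the two factors of \<open>h\<close> in \<open>P\<close>, the one at
    \<open>t + k'\<close> is bounded by \<open>N\<close>; the one at \<open>t + k\<close> gives
    summability in \<open>t\<close>, and the powers of \<open>c\<close> give it in both
    lags.\<close>
  have "(\<lambda>p. (case p of (t, k) \<Rightarrow> \<bar>h t\<bar> * \<bar>c\<bar> ^ k) * (N * (1 / (1 - \<bar>c\<bar>)))) summable_on UNIV"
    by (intro summable_on_cmult_left geometric_ell1_summable c h)
  then have "(\<lambda>(p, k'). (case p of (t, k) \<Rightarrow> \<bar>h t\<bar> * \<bar>c\<bar> ^ k) * (N * \<bar>c\<bar> ^ k')) summable_on UNIV \<times> UNIV"
  proof (rule summable_on_SigmaI[rotated])
    fix p :: "int \<times> nat"
    show "((\<lambda>k'. case (p, k') of (p, k') \<Rightarrow> (case p of (t, k) \<Rightarrow> \<bar>h t\<bar> * \<bar>c\<bar> ^ k) * (N * \<bar>c\<bar> ^ k'))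
        has_sum (case p of (t, k) \<Rightarrow> \<bar>h t\<bar> * \<bar>c\<bar> ^ k) * (N * (1 / (1 - \<bar>c\<bar>)))) UNIV"
      unfolding prod.case by (intro has_sum_cmult_right gs)
  qed (use order_trans[OF abs_ge_zero hN] in auto)
  \<comment> \<open>Translating \<open>t\<close> by the lag \<open>k\<close> moves the argument of
    \<open>h\<close> from \<open>t\<close> to \<open>t + k\<close>, as in \<open>P\<close>.\<close>
  moreover have "bij (\<lambda>(t, k, k'). ((t + int k, k), k'))"
    by (rule bij_betwI[where g="\<lambda>((t, k), k'). (t - int k, k, k')"]) auto
  ultimately have "(\<lambda>(t, k, k'). (\<bar>h (t + int k)\<bar> * \<bar>c\<bar> ^ k) * (N * \<bar>c\<bar> ^ k')) summable_on UNIV"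
    using summable_on_reindex_bij_betw[where g="\<lambda>(t, k, k'). ((t + int k, k), k')" and B=UNIV and A=UNIV
        and f="\<lambda>(p, k'). (case p of (t, k) \<Rightarrow> \<bar>h t\<bar> * \<bar>c\<bar> ^ k) * (N * \<bar>c\<bar> ^ k')"]
    by (simp add: case_prod_unfold)
  then have "(\<lambda>p. \<bar>P p\<bar>) summable_on UNIV"
  proof (rule summable_on_comparison_test)
    show "\<bar>P p\<bar> \<le> (case p of (t, k, k') \<Rightarrow> (\<bar>h (t + int k)\<bar> * \<bar>c\<bar> ^ k) * (N * \<bar>c\<bar> ^ k'))" for p
    proof (cases p)
      case (fields t k k')
      have "\<bar>h (t + int k')\<bar> * (\<bar>h (t + int k)\<bar> * \<bar>c\<bar> ^ k * \<bar>c\<bar> ^ k')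
          \<le> N * (\<bar>h (t + int k)\<bar> * \<bar>c\<bar> ^ k * \<bar>c\<bar> ^ k')"
        by (intro mult_right_mono hN) auto
      then show ?thesis by (simp add: fields P_def abs_mult power_abs power_add mult_ac)
    qed
  qed auto
  then have P: "P summable_on UNIV"
    unfolding real_norm_def[symmetric] by (rule summable_on_iff_abs_summable_on_real[THEN iffD2])
  then show "(\<lambda>(t::int, k::nat, k'::nat). c ^ (k + k') * h (t + int k') * h (t + int k))
      summable_on UNIV" by (simp add: P_def)
  have sq: "((\<lambda>q. P (t, q)) has_sum (a (t - 1))\<^sup>2) UNIV" for t
  proof -
    have s: "((\<lambda>k. c ^ k * h (t + int k)) has_sum a (t - 1)) UNIV"
      using has_sum_shift_inv[OF c h, of "t - 1"] by (simp add: a_def)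
    have "(\<lambda>(t, q). P (t, q)) summable_on UNIV \<times> UNIV" using P by simp
    then have "(\<lambda>q. P (t, q)) summable_on UNIV"
      by (rule summable_on_SigmaD1) simp
    then obtain S where S: "((\<lambda>q. P (t, q)) has_sum S) (UNIV \<times> UNIV)"
      by (auto simp: summable_on_def)
    have "((\<lambda>k. (c ^ k * h (t + int k)) * a (t - 1)) has_sum S) UNIV"
    proof (rule has_sum_Sigma'[OF S])
      fix k
      show "((\<lambda>k'. P (t, k, k')) has_sum c ^ k * h (t + int k) * a (t - 1)) UNIV"
        using has_sum_cmult_right[OF s, of "c ^ k * h (t + int k)"]
        by (simp add: P_def power_add mult_ac)
    qed
    moreover have "((\<lambda>k. (c ^ k * h (t + int k)) * a (t - 1)) has_sum a (t - 1) * a (t - 1)) UNIV"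
      by (intro has_sum_cmult_left s)
    ultimately show ?thesis using S has_sum_unique by (fastforce simp: power2_eq_square)
  qed
  obtain T where T: "(P has_sum T) (UNIV \<times> UNIV)"
    using P by (auto simp: summable_on_def)
  have 1: "((\<lambda>t. (a (t - 1))\<^sup>2) has_sum T) UNIV"
    by (rule has_sum_Sigma'[OF T]) (use sq in auto)
  \<comment> \<open>The offset between \<open>a (t - 1)\<close> and \<open>a t\<close> disappears
    because the sum runs over all integers.\<close>
  have "(\<Sum>\<^sub>\<infinity>t. \<Sum>\<^sub>\<infinity>(k::nat, k'::nat). c ^ (k + k') * h (t + int k') * h (t + int k))
      = (\<Sum>\<^sub>\<infinity>t. (a (t - 1))\<^sup>2)"
    using infsumI[OF sq] by (simp add: P_def)
  also have "\<dots> = T" by (rule infsumI[OF 1])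
  finally show "((\<lambda>t. (a t)\<^sup>2) has_sum
      (\<Sum>\<^sub>\<infinity>t. \<Sum>\<^sub>\<infinity>(k::nat, k'::nat). c ^ (k + k') * h (t + int k') * h (t + int k))) UNIV"
    using 1 has_sum_reindex_bij_betw[of "\<lambda>t::int. t - 1" UNIV UNIV "\<lambda>t. (a t)\<^sup>2" T]
      bij_betwI[of "\<lambda>t::int. t - 1" UNIV UNIV "\<lambda>t. t + 1"] by simp
qed

section \<open>Gaussian series\<close>

lemma cmod_iexp_diff_le: "cmod (iexp x - iexp y) \<le> \<bar>x - y\<bar>"
proof -
  have "iexp x - iexp y = iexp y * (iexp (x - y) - 1)"
    by (simp add: algebra_simps exp_add[symmetric])
  then have "cmod (iexp x - iexp y) = cmod (iexp (x - y) - 1)"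
    by (simp add: norm_mult)
  also have "\<dots> \<le> \<bar>x - y\<bar>"
    using iexp_approx1[of "x - y" 0] by simp
  finally show ?thesis .
qed

text \<open>The map \<open>\<lambda>x. iexp (t * x)\<close> is Lipschitz with constant
  \<open>\<bar>t\<bar>\<close>, so the characteristic functions at \<open>t\<close> differ by at
  most \<open>\<bar>t\<bar>\<close> times the mean distance.\<close>

lemma (in prob_space) char_distr_tendsto_L1:
  fixes S :: "nat \<Rightarrow> 'a \<Rightarrow> real"
  assumes S: "\<And>n. integrable M (S n)" and Z: "integrable M Z"
    and lim: "(\<lambda>n. \<integral>\<omega>. \<bar>S n \<omega> - Z \<omega>\<bar> \<partial>M) \<longlonglongrightarrow> 0"
  shows "(\<lambda>n. char (distr M borel (S n)) t) \<longlonglongrightarrow> char (distr M borel Z) t"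
proof -
  have [measurable]: "S n \<in> borel_measurable M" "Z \<in> borel_measurable M" for n
    using S Z by auto
  have ie: "integrable M (\<lambda>\<omega>. iexp (t * f \<omega>))" if [measurable]: "f \<in> borel_measurable M"
    for f :: "'a \<Rightarrow> real"
    by (intro integrable_const_bound[of _ 1]) auto
  have "dist (char (distr M borel (S n)) t) (char (distr M borel Z) t)
      \<le> \<bar>t\<bar> * (\<integral>\<omega>. \<bar>S n \<omega> - Z \<omega>\<bar> \<partial>M)" for n
  proof -
    have "dist (char (distr M borel (S n)) t) (char (distr M borel Z) t)
        = cmod (\<integral>\<omega>. iexp (t * S n \<omega>) - iexp (t * Z \<omega>) \<partial>M)"
      using ie by (simp add: char_def integral_distr dist_norm)
    also have "\<dots> \<le> (\<integral>\<omega>. cmod (iexp (t * S n \<omega>) - iexp (t * Z \<omega>)) \<partial>M)"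
      by (rule integral_norm_bound)
    also have "\<dots> \<le> (\<integral>\<omega>. \<bar>t\<bar> * \<bar>S n \<omega> - Z \<omega>\<bar> \<partial>M)"
    proof (rule integral_mono)
      fix \<omega>
      show "cmod (iexp (t * S n \<omega>) - iexp (t * Z \<omega>)) \<le> \<bar>t\<bar> * \<bar>S n \<omega> - Z \<omega>\<bar>"
        using cmod_iexp_diff_le[of "t * S n \<omega>" "t * Z \<omega>"]
        by (simp only: abs_mult right_diff_distrib[symmetric])
    qed (use ie S Z in auto)
    finally show ?thesis by simp
  qed
  note le = this
  have "(\<lambda>n. \<bar>t\<bar> * (\<integral>\<omega>. \<bar>S n \<omega> - Z \<omega>\<bar> \<partial>M)) \<longlonglongrightarrow> 0"
    by (rule tendsto_mult_right_zero[OF lim])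
  then have "(\<lambda>n. dist (char (distr M borel (S n)) t) (char (distr M borel Z) t)) \<longlonglongrightarrow> 0"
    by (rule tendsto_sandwich[OF _ _ tendsto_const, rotated -1]) (rule always_eventually, use le in simp)+
  then show ?thesis by (rule tendsto_dist_iff[THEN iffD2])
qed

lemma char_distr_scale:
  fixes X :: "'a \<Rightarrow> real"
  assumes "X \<in> borel_measurable M"
  shows "char (distr M borel (\<lambda>\<omega>. b * X \<omega>)) t = char (distr M borel X) (t * b)"
  using assms by (simp add: char_def integral_distr mult.assoc)

text \<open>By independence the characteristic functions of the partial sums are Gaussian with
  variances \<open>\<Sum>i<n. (b i)\<^sup>2\<close>. They converge to that of \<open>Z\<close> and
  also to the Gaussian one with the full variance, so uniqueness of characteristic functions
  applies. Writing the law as a scaled standard normal includes variance zero.\<close>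

lemma (in prob_space) distr_gaussian_series:
  fixes X :: "nat \<Rightarrow> 'a \<Rightarrow> real"
  assumes ind: "indep_vars (\<lambda>_. borel) X UNIV"
    and N: "\<And>i. distr M borel (X i) = std_normal_distribution"
    and int: "\<And>i. integrable M (X i)" and Z: "integrable M Z"
    and b: "summable (\<lambda>i. (b i)\<^sup>2)"
    and lim: "(\<lambda>n. \<integral>\<omega>. \<bar>(\<Sum>i<n. b i * X i \<omega>) - Z \<omega>\<bar> \<partial>M) \<longlonglongrightarrow> 0"
  shows "distr M borel Z = distr std_normal_distribution borel (\<lambda>x. sqrt (\<Sum>i. (b i)\<^sup>2) * x)"
proof (rule Levy_uniqueness)
  have [measurable]: "X i \<in> borel_measurable M" "Z \<in> borel_measurable M" for i
    using int Z by auto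
  interpret N: real_distribution std_normal_distribution by (rule real_dist_normal_dist)
  show "real_distribution (distr M borel Z)" by (rule real_distribution_distr) simp
  show "real_distribution (distr std_normal_distribution borel (\<lambda>x. sqrt (\<Sum>i. (b i)\<^sup>2) * x))"
    by (rule N.real_distribution_distr) simp
  show "char (distr M borel Z)
      = char (distr std_normal_distribution borel (\<lambda>x. sqrt (\<Sum>i. (b i)\<^sup>2) * x))"
  proof
    fix t
    have "char (distr M borel (\<lambda>\<omega>. \<Sum>i<n. b i * X i \<omega>)) t
        = of_real (exp (- (t\<^sup>2 * (\<Sum>i<n. (b i)\<^sup>2)) / 2))" for n
    proof -
      have "indep_vars (\<lambda>_. borel) (\<lambda>i \<omega>. b i * X i \<omega>) {..<n}"
        by (rule indep_vars_compose2[OF indep_vars_subset[OF ind]]) auto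
      then have "char (distr M borel (\<lambda>\<omega>. \<Sum>i<n. b i * X i \<omega>)) t
          = (\<Prod>i<n. char (distr M borel (\<lambda>\<omega>. b i * X i \<omega>)) t)"
        by (rule char_distr_sum)
      also have "\<dots> = of_real (exp (\<Sum>i<n. - ((t * b i)\<^sup>2) / 2))"
        by (simp add: char_distr_scale N char_std_normal_distribution exp_sum)
      finally show ?thesis
        by (simp add: sum_divide_distrib sum_negf sum_distrib_left power_mult_distrib)
    qed
    moreover have "(\<lambda>n. char (distr M borel (\<lambda>\<omega>. \<Sum>i<n. b i * X i \<omega>)) t)
        \<longlonglongrightarrow> char (distr M borel Z) t"
      by (rule char_distr_tendsto_L1[OF _ Z lim]) (use int in simp)
    ultimately have "(\<lambda>n. complex_of_real (exp (- (t\<^sup>2 * (\<Sum>i<n. (b i)\<^sup>2)) / 2)))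
        \<longlonglongrightarrow> char (distr M borel Z) t"
      by (simp only:)
    moreover have "(\<lambda>n. complex_of_real (exp (- (t\<^sup>2 * (\<Sum>i<n. (b i)\<^sup>2)) / 2)))
        \<longlonglongrightarrow> of_real (exp (- (t\<^sup>2 * (\<Sum>i. (b i)\<^sup>2)) / 2))"
      by (intro tendsto_intros summable_LIMSEQ b) simp
    ultimately have "char (distr M borel Z) t = of_real (exp (- (t\<^sup>2 * (\<Sum>i. (b i)\<^sup>2)) / 2))"
      by (rule LIMSEQ_unique)
    also have "\<dots> = char std_normal_distribution (t * sqrt (\<Sum>i. (b i)\<^sup>2))"
      by (simp add: char_std_normal_distribution power_mult_distrib suminf_nonneg b)
    also have "\<dots> = char (distr std_normal_distribution borel (\<lambda>x. sqrt (\<Sum>i. (b i)\<^sup>2) * x)) t"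
      by (subst char_distr_scale) (simp_all add: distr_id2)
    finally show "char (distr M borel Z) t
        = char (distr std_normal_distribution borel (\<lambda>x. sqrt (\<Sum>i. (b i)\<^sup>2) * x)) t" .
  qed
qed

text \<open>Scale zero gives a point mass and has to be separated from the affine image of a normal
  density. The moments need no such split, since they are computed on the standard normal
  side.\<close>

lemma (in prob_space) scaled_std_normal:
  assumes [measurable]: "Z \<in> borel_measurable M" and \<sigma>: "0 \<le> \<sigma>"
    and Z: "distr M borel Z = distr std_normal_distribution borel (\<lambda>x. \<sigma> * x)"
  shows "gaussian_rv M Z" "expectation Z = 0" "variance Z = \<sigma>\<^sup>2"
proof -
  interpret N: real_distribution std_normal_distribution by (rule real_dist_normal_dist)
  have "distr std_normal_distribution borel (\<lambda>x. \<sigma> * x) =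
      (if \<sigma> = 0 then return borel 0 else density lborel (normal_density 0 \<sigma>))"
  proof (cases "\<sigma> = 0")
    case True
    have "distr std_normal_distribution borel (\<lambda>x. 0 :: real) = return borel 0"
      by (rule N.distr_const) simp
    with True show ?thesis by simp
  next
    case False
    have "distr std_normal_distribution lborel (\<lambda>x. x) = std_normal_distribution"
      by (rule distr_id2) simp
    then have "distributed std_normal_distribution lborel (\<lambda>x. x) std_normal_density"
      by (simp add: distributed_def)
    from N.normal_density_affine[OF this, of \<sigma> 0] False \<sigma>
    have "distr std_normal_distribution lborel (\<lambda>x. \<sigma> * x) = density lborel (normal_density 0 \<sigma>)"
      by (simp add: distributed_def)
    moreover have "distr std_normal_distribution lborel (\<lambda>x. \<sigma> * x)
        = distr std_normal_distribution borel (\<lambda>x. \<sigma> * x)"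
      by (rule distr_cong) auto
    ultimately show ?thesis using False by simp
  qed
  then show "gaussian_rv M Z"
    using \<sigma> Z unfolding gaussian_rv_def by auto
  \<comment> \<open>Used with \<open>k = 1\<close> for the mean and \<open>k = 2\<close> for the
    variance.\<close>
  have m: "(\<integral>\<omega>. (Z \<omega>) ^ k \<partial>M) = \<sigma> ^ k * (\<integral>x. x ^ k \<partial>std_normal_distribution)" for k
  proof -
    have "(\<integral>\<omega>. (Z \<omega>) ^ k \<partial>M) = (\<integral>x. x ^ k \<partial>distr M borel Z)"
      by (simp add: integral_distr)
    also have "\<dots> = (\<integral>x. (\<sigma> * x) ^ k \<partial>std_normal_distribution)"
      unfolding Z by (rule integral_distr) auto
    finally show ?thesis by (simp add: power_mult_distrib)
  qed
  show 1: "expectation Z = 0"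
    using m[of 1] integral_std_normal_distribution_moment_odd[of 1] by simp
  show "variance Z = \<sigma>\<^sup>2"
    using m[of 2] std_normal_distribution_even_moments(1)[of 1] by (simp add: 1)
qed

text \<open>Injectivity makes the singleton blocks \<open>{f j}\<close> disjoint, so the
  restrictions to them are independent; evaluating each at its only coordinate gives the claim. It
  serves to enumerate a noise sequence and to extract one from the joint family.\<close>

lemma (in prob_space) indep_vars_reindex:
  assumes ind: "indep_vars M' X I" and f: "inj_on f J" "f ` J \<subseteq> I"
  shows "indep_vars (\<lambda>j. M' (f j)) (\<lambda>j. X (f j)) J"
proof -
  have "indep_vars (\<lambda>j. PiM {f j} M') (\<lambda>j \<omega>. restrict (\<lambda>i. X i \<omega>) {f j}) J"
    using f by (intro indep_vars_restrict[OF ind]) (auto simp: disjoint_family_on_def inj_on_def)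
  then have "indep_vars (\<lambda>j. M' (f j)) (\<lambda>j \<omega>. (\<lambda>x. x (f j)) (restrict (\<lambda>i. X i \<omega>) {f j})) J"
    by (rule indep_vars_compose2) (rule measurable_component_singleton, simp)
  then show ?thesis by simp
qed

text \<open>Reordering along the enumeration leaves the sum of squares equal to \<open>V\<close> and
  keeps the family independent, so the Gaussian limit law for sequences applies. The concrete series
  \<open>Z\<close> is kept apart from \<open>lin_comb\<close>, which equals it only almost
  everywhere.\<close>

lemma (in prob_space) iid_std_normal_series:
  fixes E :: "int \<Rightarrow> 'a \<Rightarrow> real"
  assumes Z_def: "Z = (\<lambda>\<omega>. \<Sum>n. b (from_nat_into UNIV n) * E (from_nat_into UNIV n) \<omega>)"
    and ind: "indep_vars (\<lambda>_. borel) E UNIV"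
    and N: "\<And>t. distributed M lborel (E t) std_normal_density"
    and b: "b \<in> ell1" and V: "((\<lambda>t. (b t)\<^sup>2) has_sum V) UNIV"
  shows "AE \<omega> in M. lin_comb M b E \<omega> = Z \<omega>"
    and "gaussian_rv M (Z)" "expectation (Z) = 0" "variance (Z) = V"
proof -
  define e where "e = (from_nat_into UNIV :: nat \<Rightarrow> int)"
  have e: "bij e" unfolding e_def by (rule bij_from_nat_into) (rule infinite_UNIV_int)
  define C where "C = (\<integral>x. std_normal_density x * \<bar>x\<bar> \<partial>lborel)"
  have E: "integrable M (E t)" "(\<integral>\<omega>. \<bar>E t \<omega>\<bar> \<partial>M) \<le> C" for t
    using std_normal_L1[OF prob_space_axioms N[of t]] by (simp_all add: C_def)
  note W = ell1_weighted_L1[where Z=E, OF b E]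
  show "AE \<omega> in M. lin_comb M b E \<omega> = Z \<omega>"
    using has_L1_sum_unique[OF lin_comb_has_sum(1)[where Z=E, OF b E]] W(1) by (simp add: Z_def)
  have Zi: "integrable M (Z)" using W(1) by (simp add: has_L1_sum_def Z_def)
  have s: "summable (\<lambda>n. \<integral>\<omega>. \<bar>b (e n) * E (e n) \<omega>\<bar> \<partial>M)"
  proof (rule summable_comparison_test)
    have "(\<lambda>n. \<bar>b (e n)\<bar>) summable_on UNIV"
      using b summable_on_reindex_bij_betw[OF e, of "\<lambda>t. \<bar>b t\<bar>"] by (simp add: ell1_def)
    then show "summable (\<lambda>n. \<bar>b (e n)\<bar> * C)"
      by (intro summable_mult2 summable_on_imp_summable)
    show "\<exists>N. \<forall>n\<ge>N. norm (\<integral>\<omega>. \<bar>b (e n) * E (e n) \<omega>\<bar> \<partial>M) \<le> \<bar>b (e n)\<bar> * C"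
      using E(2) by (auto simp: abs_mult intro!: mult_left_mono)
  qed
  have "has_L1_sum M (\<lambda>n \<omega>. b (e n) * E (e n) \<omega>) UNIV (Z)"
    using has_L1_sum_suminf(2)[of M "\<lambda>n \<omega>. b (e n) * E (e n) \<omega>", OF _ s] E(1)
    by (simp add: Z_def e_def)
  \<comment> \<open>The initial segments \<open>{..<n}\<close> run through the net of finite sets,
    so convergence along the net gives convergence of this sequence.\<close>
  then have lim: "(\<lambda>n. \<integral>\<omega>. \<bar>(\<Sum>i<n. b (e i) * E (e i) \<omega>) - Z \<omega>\<bar> \<partial>M) \<longlonglongrightarrow> 0"
    unfolding has_L1_sum_def by (intro filterlim_compose[OF _ filterlim_lessThan_at_top]) simp
  have "((\<lambda>n. (b (e n))\<^sup>2) has_sum V) UNIV"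
    using V has_sum_reindex_bij_betw[OF e, of "\<lambda>t. (b t)\<^sup>2"] by simp
  then have sq: "(\<lambda>n. (b (e n))\<^sup>2) sums V" by (rule has_sum_imp_sums)
  have "indep_vars (\<lambda>_. borel) (\<lambda>n. E (e n)) UNIV"
    using indep_vars_reindex[OF ind, of e UNIV] e by (simp add: bij_def)
  moreover have "distr M borel (E t) = std_normal_distribution" for t
  proof -
    have "distr M borel (E t) = distr M lborel (E t)" by (rule distr_cong) auto
    then show ?thesis using N[of t] by (simp add: distributed_def)
  qed
  ultimately have "distr M borel (Z)
      = distr std_normal_distribution borel (\<lambda>x. sqrt (\<Sum>n. (b (e n))\<^sup>2) * x)"
    by (intro distr_gaussian_series[OF _ _ E(1) Zi sums_summable[OF sq] lim])
  then have d: "distr M borel (Z) = distr std_normal_distribution borel (\<lambda>x. sqrt V * x)"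
    using sums_unique[OF sq] by simp
  have "0 \<le> V" by (rule has_sum_nonneg[OF V]) simp
  with scaled_std_normal[OF borel_measurable_integrable[OF Zi] _ d]
  show "gaussian_rv M (Z)" "expectation (Z) = 0" "variance (Z) = V" by simp_all
qed

text \<open>Each series is a measurable function of one block of the joint family, and the blocks
  \<open>range Inl\<close> and \<open>range Inr\<close> are disjoint. The explicit series matters
  here: it exhibits the dependence on the coordinates, unlike a version picked by
  \<open>L1_sum\<close>.\<close>

lemma (in prob_space) indep_series:
  fixes E E' :: "int \<Rightarrow> 'a \<Rightarrow> real" and b b' :: "int \<Rightarrow> real" and e :: "nat \<Rightarrow> int"
  assumes ind: "indep_vars (\<lambda>_. borel) (case_sum E E') UNIV"
  shows "indep_var borel (\<lambda>\<omega>. \<Sum>n. b (e n) * E (e n) \<omega>) borel (\<lambda>\<omega>. \<Sum>n. b' (e n) * E' (e n) \<omega>)"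
proof -
  have Inl: "(\<lambda>x. x (Inl t)) \<in> borel_measurable (PiM (range Inl) (\<lambda>_. borel :: real measure))" for t :: int
    by (rule measurable_component_singleton) simp
  have Inr: "(\<lambda>x. x (Inr t)) \<in> borel_measurable (PiM (range Inr) (\<lambda>_. borel :: real measure))" for t :: int
    by (rule measurable_component_singleton) simp
  have "indep_var borel ((\<lambda>x. \<Sum>n. b (e n) * x (Inl (e n))) \<circ> (\<lambda>\<omega>. \<lambda>i\<in>range Inl. case_sum E E' i \<omega>))
      borel ((\<lambda>x. \<Sum>n. b' (e n) * x (Inr (e n))) \<circ> (\<lambda>\<omega>. \<lambda>i\<in>range Inr. case_sum E E' i \<omega>))"
    by (rule indep_var_compose[OF indep_var_restrict[OF ind]])
      (use Inl Inr in \<open>auto intro!: borel_measurable_suminf borel_measurable_times\<close>)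
  then show ?thesis by (simp add: comp_def)
qed

section \<open>Regular conditional distributions\<close>

text \<open>Distribution functions are right continuous, so a difference at one point would persist
  on an interval to its right, which contains a rational. Countably many test sets are what allows
  the passage from each set to almost every point below.\<close>

lemma measure_eqI_atMost_rat:
  assumes "real_distribution K" "real_distribution L"
    and eq: "\<And>q :: rat. measure K {..of_rat q} = measure L {..of_rat q}"
  shows "K = L"
proof (rule cdf_unique[OF assms(1,2)], rule ext, rule ccontr)
  interpret K: real_distribution K by fact
  interpret L: real_distribution L by fact
  fix x assume "cdf K x \<noteq> cdf L x"
  moreover have "((\<lambda>y. cdf K y - cdf L y) \<longlongrightarrow> cdf K x - cdf L x) (at_right x)"
    using K.cdf_is_right_cont[of x] L.cdf_is_right_cont[of x]
    by (intro tendsto_diff) (auto simp: continuous_within)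
  ultimately have "\<forall>\<^sub>F y in at_right x. cdf K y - cdf L y \<noteq> 0"
    by (intro tendsto_imp_eventually_ne) auto
  then obtain b where b: "x < b" "\<And>y. x < y \<Longrightarrow> y < b \<Longrightarrow> cdf K y - cdf L y \<noteq> 0"
    by (auto simp: eventually_at_right_field)
  obtain q where "x < of_rat q" "of_rat q < b" using of_rat_dense[OF b(1)] by blast
  with b(2) eq show False by (auto simp: cdf_def)
qed

text \<open>For a fixed \<open>B\<close> the two masses of \<open>B\<close> have the same integral
  over every \<open>A\<close>, hence agree almost everywhere. Taking for \<open>B\<close> the
  countably many rational half-lines gives one null set outside which the kernels coincide.\<close>

lemma is_cond_distr_unique:
  assumes M: "prob_space M" and U: "U \<in> borel_measurable M"
    and K: "is_cond_distr M U V K" and L: "is_cond_distr M U V L"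
  shows "AE x in distr M borel U. K x = L x"
proof -
  interpret M: prob_space M by fact
  interpret D: prob_space "distr M borel U" using U by (rule M.prob_space_distr)
  have Km[measurable]: "K \<in> borel \<rightarrow>\<^sub>M prob_algebra borel" and Lm[measurable]: "L \<in> borel \<rightarrow>\<^sub>M prob_algebra borel"
    using K L by (auto simp: is_cond_distr_def)
  have m: "(\<lambda>x. emeasure (J x) B) \<in> borel_measurable (distr M borel U)"
    if "J \<in> borel \<rightarrow>\<^sub>M prob_algebra borel" "B \<in> sets borel" for J and B :: "real set"
    using measurable_compose[OF measurable_prob_algebraD[OF that(1)] measurable_emeasure_subprob_algebra[OF that(2)]]
    by simp
  have "AE x in distr M borel U. emeasure (K x) B = emeasure (L x) B" if B: "B \<in> sets borel" for B
  proof (rule D.density_unique_finite_measure)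
    fix A assume "A \<in> sets (distr M borel U)"
    then have "A \<in> sets borel" by simp
    then show "(\<integral>\<^sup>+ x. emeasure (K x) B * indicator A x \<partial>distr M borel U)
        = (\<integral>\<^sup>+ x. emeasure (L x) B * indicator A x \<partial>distr M borel U)"
      using K L B by (simp add: is_cond_distr_def)
  qed (use m Km Lm B in auto)
  then have "AE x in distr M borel U. \<forall>q::rat. emeasure (K x) {..of_rat q} = emeasure (L x) {..of_rat q}"
    by (simp add: AE_all_countable)
  then show ?thesis
  proof eventually_elim
    case (elim x)
    have "real_distribution (J x)" if "J \<in> borel \<rightarrow>\<^sub>M prob_algebra borel" for J :: "real \<Rightarrow> real measure"
      using measurable_space[OF that, of x]
      by (auto simp: space_prob_algebra real_distribution_def real_distribution_axioms_def)
    then show ?case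
      using elim Km Lm by (intro measure_eqI_atMost_rat) (auto simp: measure_def)
  qed
qed

text \<open>Independence makes the joint law of \<open>S\<close> and \<open>W\<close> a product, and
  integrating over sections yields the law of \<open>u + W\<close> as the kernel. \<open>U\<close>
  is separate from \<open>S\<close> because independence is known for a particular version
  only.\<close>

lemma is_cond_distr_add:
  assumes M: "prob_space M" and ind: "prob_space.indep_var M borel S borel W"
    and [measurable]: "U \<in> borel_measurable M" "V \<in> borel_measurable M"
    and U: "AE \<omega> in M. U \<omega> = S \<omega>" and V: "AE \<omega> in M. V \<omega> = U \<omega> + W \<omega>"
  shows "is_cond_distr M U V (\<lambda>x. distr M borel (\<lambda>\<omega>. x + W \<omega>))"
  unfolding is_cond_distr_def
proof (intro conjI ballI)
  interpret M: prob_space M by fact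
  have [measurable]: "S \<in> borel_measurable M" "W \<in> borel_measurable M"
    using M.indep_var_rv1[OF ind] M.indep_var_rv2[OF ind] by auto
  interpret W: prob_space "distr M borel W" by (rule M.prob_space_distr) simp
  \<comment> \<open>The kernel is the image of the constant kernel \<open>M\<close> under a jointly
    measurable map, hence measurable in \<open>x\<close>.\<close>
  have "(\<lambda>_. M) \<in> borel \<rightarrow>\<^sub>M prob_algebra M"
    by (rule measurable_const) (simp add: space_prob_algebra M)
  then show "(\<lambda>x. distr M borel (\<lambda>\<omega>. x + W \<omega>)) \<in> borel \<rightarrow>\<^sub>M prob_algebra borel"
    by (rule measurable_distr_prob_space2) measurable
  fix A B :: "real set" assume [measurable]: "A \<in> sets borel" "B \<in> sets borel"
  \<comment> \<open>\<open>T\<close> expresses the event in the plane of pairs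
    \<open>(S, W)\<close>; its section at \<open>u\<close> is a translate of \<open>B\<close> if
    \<open>u\<close> lies in \<open>A\<close>, and empty otherwise.\<close>
  define T where "T = {p \<in> space (borel \<Otimes>\<^sub>M borel). fst p \<in> A \<and> fst p + snd p \<in> B}"
  have T[measurable]: "T \<in> sets (borel \<Otimes>\<^sub>M borel)"
    unfolding T_def by measurable
  have "emeasure M {\<omega> \<in> space M. U \<omega> \<in> A \<and> V \<omega> \<in> B}
      = emeasure M {\<omega> \<in> space M. S \<omega> \<in> A \<and> S \<omega> + W \<omega> \<in> B}"
    using U V by (intro emeasure_eq_AE) auto
  also have "\<dots> = emeasure (distr M (borel \<Otimes>\<^sub>M borel) (\<lambda>\<omega>. (S \<omega>, W \<omega>))) T"
    by (subst emeasure_distr[OF _ T])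
      (auto simp: T_def space_pair_measure intro!: arg_cong[where f="emeasure M"])
  also have "\<dots> = emeasure (distr M borel S \<Otimes>\<^sub>M distr M borel W) T"
    using ind by (simp add: M.indep_var_distribution_eq)
  also have "\<dots> = (\<integral>\<^sup>+ u. emeasure (distr M borel W) (Pair u -` T) \<partial>distr M borel S)"
    by (rule W.emeasure_pair_measure_alt) simp
  also have "\<dots> = (\<integral>\<^sup>+ u \<in> A. emeasure (distr M borel (\<lambda>\<omega>. u + W \<omega>)) B \<partial>distr M borel S)"
  proof (rule nn_integral_cong)
    fix u
    have "Pair u -` T = (if u \<in> A then {w. u + w \<in> B} else {})"
      by (auto simp: T_def space_pair_measure)
    moreover have "emeasure (distr M borel W) {w. u + w \<in> B} = emeasure (distr M borel (\<lambda>\<omega>. u + W \<omega>)) B"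
    proof -
      have "{w \<in> space borel. u + w \<in> B} \<in> sets borel" by measurable
      then show ?thesis by (simp add: emeasure_distr vimage_def)
    qed
    ultimately show "emeasure (distr M borel W) (Pair u -` T)
        = emeasure (distr M borel (\<lambda>\<omega>. u + W \<omega>)) B * indicator A u"
      by (auto simp: indicator_def)
  qed
  also have "distr M borel S = distr M borel U"
    using U by (intro distr_cong_AE) auto
  finally show "emeasure M {\<omega> \<in> space M. U \<omega> \<in> A \<and> V \<omega> \<in> B}
      = (\<integral>\<^sup>+ u \<in> A. emeasure (distr M borel (\<lambda>\<omega>. u + W \<omega>)) B \<partial>distr M borel U)" .
qed

section \<open>The structural equation\<close>

lemma integral_abs_add_le:
  fixes u v :: "'a \<Rightarrow> real"
  assumes "integrable M u" "integrable M v"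
  shows "(\<integral>\<omega>. \<bar>u \<omega> + v \<omega>\<bar> \<partial>M) \<le> (\<integral>\<omega>. \<bar>u \<omega>\<bar> \<partial>M) + (\<integral>\<omega>. \<bar>v \<omega>\<bar> \<partial>M)"
proof -
  have "(\<integral>\<omega>. \<bar>u \<omega> + v \<omega>\<bar> \<partial>M) \<le> (\<integral>\<omega>. \<bar>u \<omega>\<bar> + \<bar>v \<omega>\<bar> \<partial>M)"
    using assms by (intro integral_mono) auto
  then show ?thesis using assms by simp
qed

lemma ell1_times_bounded_summable:
  assumes f: "f \<in> ell1" and xs: "bounded (range xs)"
  shows "(\<lambda>t. f t * xs t) summable_on UNIV"
proof -
  obtain B where B: "\<And>t. \<bar>xs t\<bar> \<le> B" using xs by (auto simp: bounded_iff)
  have "(\<lambda>t. \<bar>f t\<bar> * B) summable_on UNIV"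
    using f by (intro summable_on_cmult_left) (simp add: ell1_def)
  then have "(\<lambda>t. norm (f t * xs t)) summable_on UNIV"
    by (rule Infinite_Sum.abs_summable_on_comparison_test')
      (auto simp: abs_mult intro!: mult_left_mono B)
  then show ?thesis by (rule abs_summable_summable)
qed

text \<open>Linear combinations are defined by choice and infinite sums default to zero, so the
  summability conjuncts certify that the variables and variances are genuine. A conditional
  distribution is determined only up to null sets, hence a kernel is both exhibited and shown to be
  almost everywhere the only one.\<close>

theorem theorem1:
  fixes M :: "'a measure"
    and eX eY X Y :: "int \<Rightarrow> 'a \<Rightarrow> real"
    and \<alpha> \<beta> \<gamma> :: real
    and f g :: "int \<Rightarrow> real"
    and Xf Yg :: "'a \<Rightarrow> real"
  assumes "prob_space M"
    and "jointly_iid_std_normal M eX eY"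
    and "\<bar>\<alpha>\<bar> < 1" and "\<bar>\<gamma>\<bar> < 1"
    and "stationary_solution M \<alpha> \<beta> \<gamma> eX eY X Y"
    and "f \<in> ell1" and "g \<in> ell1"
    and "f = (\<lambda>t. \<beta> * shift (inv_id_minus_shift \<gamma> g) t)"
    and "Xf = lin_comb M f X" and "Yg = lin_comb M g Y"
  shows "L1_summable M (\<lambda>t \<omega>. f t * X t \<omega>) UNIV \<and>
    L1_summable M (\<lambda>t \<omega>. g t * Y t \<omega>) UNIV \<and>
    (\<exists>EtX EtY.
      prob_space.indep_var M borel EtX borel EtY \<and>
      gaussian_rv M EtX \<and> prob_space.expectation M EtX = 0 \<and>
      gaussian_rv M EtY \<and> prob_space.expectation M EtY = 0 \<and>
      (AE \<omega> in M. Xf \<omega> = EtX \<omega>) \<and>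
      (AE \<omega> in M. Yg \<omega> = Xf \<omega> + EtY \<omega>) \<and>
      (\<lambda>(t::int, k::nat, k'::nat). \<alpha> ^ (k + k') * f (t + int k') * f (t + int k))
        summable_on UNIV \<and>
      prob_space.variance M EtX =
        (\<Sum>\<^sub>\<infinity>t. \<Sum>\<^sub>\<infinity>(k::nat, k'::nat). \<alpha> ^ (k + k') * f (t + int k') * f (t + int k)) \<and>
      (\<lambda>(t::int, k::nat, k'::nat). \<gamma> ^ (k + k') * g (t + int k') * g (t + int k))
        summable_on UNIV \<and>
      prob_space.variance M EtY =
        (\<Sum>\<^sub>\<infinity>t. \<Sum>\<^sub>\<infinity>(k::nat, k'::nat). \<gamma> ^ (k + k') * g (t + int k') * g (t + int k)) \<and>
      is_cond_distr M Xf Yg (\<lambda>x. distr M borel (\<lambda>\<omega>. x + EtY \<omega>)) \<and>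
      (\<forall>K. is_cond_distr M Xf Yg K \<longrightarrow>
        (AE x in distr M borel Xf. K x = distr M borel (\<lambda>\<omega>. x + EtY \<omega>))) \<and>
      (\<forall>x xs Ydo.
        bounded (range xs) \<and> ((\<lambda>t. f t * xs t) has_sum x) UNIV \<and>
        do_solution M \<beta> \<gamma> eY xs Ydo \<longrightarrow>
          L1_summable M (\<lambda>t \<omega>. g t * Ydo t \<omega>) UNIV \<and>
          distr M borel (lin_comb M g Ydo) = distr M borel (\<lambda>\<omega>. x + EtY \<omega>)) \<and>
      (\<forall>xs xs' Ydo Ydo'.
        bounded (range xs) \<and> bounded (range xs') \<and>
        (\<Sum>\<^sub>\<infinity>t. f t * xs t) = (\<Sum>\<^sub>\<infinity>t. f t * xs' t) \<and>
        do_solution M \<beta> \<gamma> eY xs Ydo \<and> do_solution M \<beta> \<gamma> eY xs' Ydo' \<longrightarrow>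
          distr M borel (lin_comb M g Ydo) = distr M borel (lin_comb M g Ydo')))"
proof -
  interpret prob_space M by fact
  note E = assms(2)[unfolded jointly_iid_std_normal_def]
  \<comment> \<open>\<open>af s\<close> is the weight of \<open>eX s\<close> in \<open>Xf\<close>,
    and \<open>ag s\<close> the weight in \<open>Yg\<close> of the innovation of \<open>Y\<close> at
    time \<open>s\<close>. The noise variables are taken as concrete series, so that their
    independence can be read off.\<close>
  define af where "af = shift (inv_id_minus_shift \<alpha> f)"
  define ag where "ag = shift (inv_id_minus_shift \<gamma> g)"
  define EtX where "EtX = (\<lambda>\<omega>. \<Sum>n. af (from_nat_into UNIV n) * eX (from_nat_into UNIV n) \<omega>)"
  define EtY where "EtY = (\<lambda>\<omega>. \<Sum>n. ag (from_nat_into UNIV n) * eY (from_nat_into UNIV n) \<omega>)"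
  define C where "C = (\<integral>x. std_normal_density x * \<bar>x\<bar> \<partial>lborel)"
  have eX: "integrable M (eX t)" "(\<integral>\<omega>. \<bar>eX t \<omega>\<bar> \<partial>M) \<le> C" for t
    using std_normal_L1[of M "eX t"] E assms(1) by (simp_all add: C_def)
  have eY: "integrable M (eY t)" "(\<integral>\<omega>. \<bar>eY t \<omega>\<bar> \<partial>M) \<le> C" for t
    using std_normal_L1[of M "eY t"] E assms(1) by (simp_all add: C_def)
  have arX: "ar1_solution M \<alpha> eX X" and arY: "ar1_solution M \<gamma> (\<lambda>t \<omega>. \<beta> * X t \<omega> + eY t \<omega>) Y"
    using assms(5) by (auto simp: stationary_solution_def)
  have af: "af \<in> ell1" and ag: "ag \<in> ell1"
    unfolding af_def ag_def using assms by (auto intro: shift_inv_ell1)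
  \<comment> \<open>This is where the relation between \<open>f\<close> and \<open>g\<close> enters:
    weighting the input \<open>\<beta> * X t\<close> of \<open>Y\<close> by \<open>ag t\<close>
    produces exactly the summand \<open>f t * X t\<close>.\<close>
  have f_ag: "f t = \<beta> * ag t" for t by (subst assms(8)) (simp add: ag_def)

  define CX where "CX = C / (1 - \<bar>\<alpha>\<bar>)"
  have X: "integrable M (X t)" "(\<integral>\<omega>. \<bar>X t \<omega>\<bar> \<partial>M) \<le> CX" for t
    using ar1_solution_integrable[OF arX] ar1_solution_suminf(2)[OF assms(3) eX arX]
    by (simp_all add: CX_def)
  have U: "integrable M (\<lambda>\<omega>. \<beta> * X t \<omega> + eY t \<omega>)" for t
    using X eY by auto
  have UB: "(\<integral>\<omega>. \<bar>\<beta> * X t \<omega> + eY t \<omega>\<bar> \<partial>M) \<le> \<bar>\<beta>\<bar> * CX + C" for t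
  proof -
    have "(\<integral>\<omega>. \<bar>\<beta> * X t \<omega> + eY t \<omega>\<bar> \<partial>M) \<le> \<bar>\<beta>\<bar> * (\<integral>\<omega>. \<bar>X t \<omega>\<bar> \<partial>M) + (\<integral>\<omega>. \<bar>eY t \<omega>\<bar> \<partial>M)"
      using integral_abs_add_le[of M "\<lambda>\<omega>. \<beta> * X t \<omega>" "eY t"] X eY by (simp add: abs_mult)
    also have "\<dots> \<le> \<bar>\<beta>\<bar> * CX + C"
      by (intro add_mono mult_left_mono X eY) auto
    finally show ?thesis .
  qed
  have Y: "integrable M (Y t)" "(\<integral>\<omega>. \<bar>Y t \<omega>\<bar> \<partial>M) \<le> (\<bar>\<beta>\<bar> * CX + C) / (1 - \<bar>\<gamma>\<bar>)" for t
    using ar1_solution_integrable[OF arY] ar1_solution_suminf(2)[OF assms(4) U UB arY]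
    by simp_all
  note Xf_sum = lin_comb_has_sum[where Z=X, OF assms(6) X, folded assms(9)]
  note Yg_sum = lin_comb_has_sum[where Z=Y, OF assms(7) Y, folded assms(10)]

  note sqX = sum_shift_inv_squared[OF assms(3) assms(6)]
  note sqY = sum_shift_inv_squared[OF assms(4) assms(7)]
  have indX: "indep_vars (\<lambda>_. borel) eX UNIV" and indY: "indep_vars (\<lambda>_. borel) eY UNIV"
    using indep_vars_reindex[of "\<lambda>_. borel" "case_sum eX eY" UNIV Inl UNIV]
      indep_vars_reindex[of "\<lambda>_. borel" "case_sum eX eY" UNIV Inr UNIV] E by simp_all
  note GX = iid_std_normal_series[OF EtX_def indX E[THEN conjunct2, THEN conjunct1, rule_format]
      af sqX(2)[folded af_def]]
  note GY = iid_std_normal_series[OF EtY_def indY E[THEN conjunct2, THEN conjunct2, rule_format]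
      ag sqY(2)[folded ag_def]]
  have ind: "indep_var borel EtX borel EtY"
    unfolding EtX_def EtY_def using E by (intro indep_series) simp
  have [measurable]: "EtX \<in> borel_measurable M" "EtY \<in> borel_measurable M"
    using indep_var_rv1[OF ind] indep_var_rv2[OF ind] by auto
  have [measurable]: "Xf \<in> borel_measurable M" "Yg \<in> borel_measurable M"
    using Xf_sum(1) Yg_sum(1) by (auto simp: has_L1_sum_def)

  have XfE: "AE \<omega> in M. Xf \<omega> = EtX \<omega>"
    using ar1_lin_comb[OF assms(3) eX arX assms(6), folded af_def assms(9)] GX(1)
    by eventually_elim simp
  have eYsum: "AE \<omega> in M. ((\<lambda>t. ag t * eY t \<omega>) has_sum EtY \<omega>) UNIV"
    using ell1_weighted_L1(2)[where Z=eY, OF ag eY] by (simp add: EtY_def)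
  \<comment> \<open>At almost every \<open>\<omega>\<close> the sum of the weighted innovations of
    \<open>Y\<close> splits by \<open>f_ag\<close> into the sums for \<open>Xf\<close> and
    \<open>EtY\<close>.\<close>
  have YgE: "AE \<omega> in M. Yg \<omega> = Xf \<omega> + EtY \<omega>"
    using ar1_lin_comb[OF assms(4) U UB arY assms(7), folded ag_def assms(10)] eYsum Xf_sum(2)
      lin_comb_has_sum(2)[where Z="\<lambda>t \<omega>. \<beta> * X t \<omega> + eY t \<omega>", OF ag U UB]
  proof eventually_elim
    case (elim \<omega>)
    have "((\<lambda>t. f t * X t \<omega> + ag t * eY t \<omega>) has_sum Xf \<omega> + EtY \<omega>) UNIV"
      by (rule has_sum_add[OF elim(3,2)])
    then have "((\<lambda>t. ag t * (\<beta> * X t \<omega> + eY t \<omega>)) has_sum Xf \<omega> + EtY \<omega>) UNIV"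
      by (simp add: f_ag algebra_simps)
    from has_sum_unique[OF elim(4) this] elim(1) show ?case by simp
  qed

  \<comment> \<open>The splitting for \<open>Yg\<close> is repeated with the constants
    \<open>xs t\<close> in place of \<open>X t\<close>, so \<open>x\<close> takes the place of
    \<open>Xf\<close>. The result is an almost sure identity with the same \<open>EtY\<close>, from
    which equality of the laws follows.\<close>
  have intervention: "L1_summable M (\<lambda>t \<omega>. g t * Ydo t \<omega>) UNIV \<and>
      distr M borel (lin_comb M g Ydo) = distr M borel (\<lambda>\<omega>. x + EtY \<omega>)"
    if xs: "bounded (range xs)" and x: "((\<lambda>t. f t * xs t) has_sum x) UNIV"
      and "do_solution M \<beta> \<gamma> eY xs Ydo" for x xs Ydo
  proof -
    have ar: "ar1_solution M \<gamma> (\<lambda>t \<omega>. \<beta> * xs t + eY t \<omega>) Ydo"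
      using that by (simp add: do_solution_def)
    obtain B where B: "\<And>t. \<bar>xs t\<bar> \<le> B" using xs by (auto simp: bounded_iff)
    have U: "integrable M (\<lambda>\<omega>. \<beta> * xs t + eY t \<omega>)" for t using eY by auto
    have UB: "(\<integral>\<omega>. \<bar>\<beta> * xs t + eY t \<omega>\<bar> \<partial>M) \<le> \<bar>\<beta>\<bar> * B + C" for t
    proof -
      have "(\<integral>\<omega>. \<bar>\<beta> * xs t + eY t \<omega>\<bar> \<partial>M) \<le> \<bar>\<beta>\<bar> * \<bar>xs t\<bar> + (\<integral>\<omega>. \<bar>eY t \<omega>\<bar> \<partial>M)"
        using integral_abs_add_le[of M "\<lambda>\<omega>. \<beta> * xs t" "eY t"] eY by (simp add: abs_mult prob_space)
      also have "\<dots> \<le> \<bar>\<beta>\<bar> * B + C"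
        by (intro add_mono mult_left_mono B eY) auto
      finally show ?thesis .
    qed
    have Yd: "integrable M (Ydo t)" "(\<integral>\<omega>. \<bar>Ydo t \<omega>\<bar> \<partial>M) \<le> (\<bar>\<beta>\<bar> * B + C) / (1 - \<bar>\<gamma>\<bar>)" for t
      using ar1_solution_integrable[OF ar] ar1_solution_suminf(2)[OF assms(4) U UB ar] by simp_all
    note L = lin_comb_has_sum(1)[where Z=Ydo, OF assms(7) Yd]
    have "AE \<omega> in M. lin_comb M g Ydo \<omega> = x + EtY \<omega>"
      using ar1_lin_comb[OF assms(4) U UB ar assms(7), folded ag_def] eYsum
        lin_comb_has_sum(2)[where Z="\<lambda>t \<omega>. \<beta> * xs t + eY t \<omega>", OF ag U UB]
    proof eventually_elim
      case (elim \<omega>)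
      have "((\<lambda>t. f t * xs t + ag t * eY t \<omega>) has_sum x + EtY \<omega>) UNIV"
        by (rule has_sum_add[OF x elim(2)])
      then have "((\<lambda>t. ag t * (\<beta> * xs t + eY t \<omega>)) has_sum x + EtY \<omega>) UNIV"
        by (simp add: f_ag algebra_simps)
      from has_sum_unique[OF elim(3) this] elim(1) show ?case by simp
    qed
    moreover have "lin_comb M g Ydo \<in> borel_measurable M"
      using L by (auto simp: has_L1_sum_def)
    ultimately have "distr M borel (lin_comb M g Ydo) = distr M borel (\<lambda>\<omega>. x + EtY \<omega>)"
      by (intro distr_cong_AE) auto
    with L show ?thesis by (auto simp: L1_summable_def)
  qed
  \<comment> \<open>Bounded sequences are summable against \<open>f\<close>, so both laws are given
    by the previous fact, with the common sum as \<open>x\<close>.\<close>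
  have intervention_eq: "distr M borel (lin_comb M g Ydo) = distr M borel (lin_comb M g Ydo')"
    if "bounded (range xs)" "bounded (range xs')"
      "(\<Sum>\<^sub>\<infinity>t. f t * xs t) = (\<Sum>\<^sub>\<infinity>t. f t * xs' t)"
      "do_solution M \<beta> \<gamma> eY xs Ydo" "do_solution M \<beta> \<gamma> eY xs' Ydo'" for xs xs' Ydo Ydo'
    using intervention[OF that(1) has_sum_infsum[OF ell1_times_bounded_summable[OF assms(6) that(1)]] that(4)]
      intervention[OF that(2) has_sum_infsum[OF ell1_times_bounded_summable[OF assms(6) that(2)]] that(5)]
      that(3) by simp

  have cond: "is_cond_distr M Xf Yg (\<lambda>x. distr M borel (\<lambda>\<omega>. x + EtY \<omega>))"
    by (rule is_cond_distr_add[OF assms(1) ind _ _ XfE YgE]) simp_all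

  show ?thesis
  proof (rule conjI[OF _ conjI[OF _ exI[of _ EtX, OF exI[of _ EtY]]]]; (intro conjI)?)
    show "L1_summable M (\<lambda>t \<omega>. f t * X t \<omega>) UNIV" "L1_summable M (\<lambda>t \<omega>. g t * Y t \<omega>) UNIV"
      using Xf_sum(1) Yg_sum(1) by (auto simp: L1_summable_def)
    show "\<forall>K. is_cond_distr M Xf Yg K \<longrightarrow>
        (AE x in distr M borel Xf. K x = distr M borel (\<lambda>\<omega>. x + EtY \<omega>))"
      using is_cond_distr_unique[OF assms(1) _ _ cond] by simp
    show "\<forall>x xs Ydo. bounded (range xs) \<and> ((\<lambda>t. f t * xs t) has_sum x) UNIV \<and>
        do_solution M \<beta> \<gamma> eY xs Ydo \<longrightarrow>
          L1_summable M (\<lambda>t \<omega>. g t * Ydo t \<omega>) UNIV \<and>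
          distr M borel (lin_comb M g Ydo) = distr M borel (\<lambda>\<omega>. x + EtY \<omega>)"
      using intervention by blast
    show "\<forall>xs xs' Ydo Ydo'. bounded (range xs) \<and> bounded (range xs') \<and>
        (\<Sum>\<^sub>\<infinity>t. f t * xs t) = (\<Sum>\<^sub>\<infinity>t. f t * xs' t) \<and>
        do_solution M \<beta> \<gamma> eY xs Ydo \<and> do_solution M \<beta> \<gamma> eY xs' Ydo' \<longrightarrow>
          distr M borel (lin_comb M g Ydo) = distr M borel (lin_comb M g Ydo')"
      using intervention_eq by blast
  qed (fact ind GX GY XfE YgE sqX(1) sqY(1) cond)+
qed

end
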